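(* In the free Carnot group $\mathbb F_{23}$ of rank $2$ and step $3$, identified with $\mathbb R^5$ by exponential coordinates of the second kind, consider the set $$\mathcal C:=\{x\in\mathbb R^5: x_2\ge0,\ x_4\ge0,\ x_5^2\le 2\,x_2^3\,x_4\}.$$ Let $K\subset[0,1]$ be the Cantor set of positive measure constructed from a sequence $(a_n)_{n\ge 0}$ as described in the context, and define $$E:=\bigcup_{t\in K}L_{\exp(tX_5)}(\mathcal C),$$ where $L_g$ denotes left translation by $g$. Then $E$ is a set with constant normal, but $E$ is not a set of locally finite Euclidean perimeter in $\mathbb R^5$.
   Context: The Lie algebra of $\mathbb F_{23}$ has basis $X_1,\dots,X_5$ with only nontrivial brackets $X_3=[X_2,X_1]$, $X_4=[X_3,X_1]$, $X_5=[X_3,X_2]$, and first layer $V_1=\mathrm{span}\{X_1,X_2\}$. The point $x\in\mathbb R^5$ is identified with $\exp(x_5X_5)\exp(x_4X_4)\cdots\exp(x_1X_1)$. The group law is $$x\cdot y=\big(x_1+y_1,\ x_2+y_2,\ x_3+y_3-x_1y_2,\ x_4+y_4-x_1y_3+\tfrac12x_1^2y_2,\ x_5+y_5+x_1x_2y_2+\tfrac12x_1y_2^2-x_2y_3\big),$$ and the generating left-invariant fields are $X_1=\partial_1$, $X_2=\partial_2-x_1\partial_3+\frac{x_1^2}{2}\partial_4+x_1x_2\partial_5$; also $X_5=\partial_5$. Construction of $K$: let $a_0,a_1,\dots>0$ satisfy $\sum_{j\ge0}a_j<1$ and $\lim_{n\to\infty}2^na_n^2=+\infty$. From $[0,1]$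 remove the open segment of length $a_0$ centered at $1/2$, leaving two closed segments $I_{0,1},I_{0,2}$. At step $n\ge1$, from each of the $2^n$ closed segments $I_{n-1,1},\dots,I_{n-1,2^n}$ remove the concentric open segment of length $a_n/2^n$, leaving $2^{n+1}$ closed segments $I_{n,1},\dots,I_{n,2^{n+1}}$. Let $K=\bigcap_n\bigcup_kI_{n,k}$. A measurable set $E$ has constant normal if there is a closed half-space $W\subset V_1$ (bounded by a line through the origin) such that for all $X\in W$, $X\mathbb 1_E\ge0$ in the sense of distributions, i.e. $-\int_EXu\ge0$ for all $0\le u\in C_c^\infty$ (integration with respect to the Haar measure, which in these coordinates is Lebesgue measure). $E$ has locally finite Euclidean perimeter if all distributional partial derivatives $\partial_i\mathbb 1_E$, $i=1,\dots,5$, are Radon measures on $\mathbb R^5$. *)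

theory Defs
  imports "HOL-Analysis.Analysis"
begin

text \<open>
  The free Carnot group of rank 2 and step 3 is realised on \<open>real^5\<close> through exponential coordinates of the second kind:
  the point \<open>x\<close> stands for \<open>exp (x\<^sub>5 X\<^sub>5) exp (x\<^sub>4 X\<^sub>4) \<dots> exp (x\<^sub>1 X\<^sub>1)\<close>, where
  \<open>X\<^sub>3 = [X\<^sub>2,X\<^sub>1]\<close>, \<open>X\<^sub>4 = [X\<^sub>3,X\<^sub>1]\<close>, \<open>X\<^sub>5 = [X\<^sub>3,X\<^sub>2]\<close>.
  Pitfall: the index type \<open>5\<close> is the integers modulo 5, so \<open>x $ 5\<close> is \<open>x $ 0\<close>, and
  \<open>vector [p, q, r, s, t]\<close> has components \<open>1, \<dots>, 5\<close> in this order.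
\<close>

definition F23_mult :: "real^5 \<Rightarrow> real^5 \<Rightarrow> real^5" (infixl "\<odot>" 70) where
  "x \<odot> y = vector
     [x$1 + y$1,
      x$2 + y$2,
      x$3 + y$3 - x$1 * y$2,
      x$4 + y$4 - x$1 * y$3 + (x$1)\<^sup>2 * y$2 / 2,
      x$5 + y$5 + x$1 * x$2 * y$2 + x$1 * (y$2)\<^sup>2 / 2 - x$2 * y$3]"

text \<open>In these coordinates \<open>exp (t X\<^sub>i)\<close> is the point \<open>t e\<^sub>i\<close>.\<close>

definition F23_exp :: "5 \<Rightarrow> real \<Rightarrow> real^5" where
  "F23_exp i t = axis i t"

definition left_translation :: "real^5 \<Rightarrow> real^5 \<Rightarrow> real^5" where
  "left_translation g = (\<lambda>x. g \<odot> x)"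

definition X1 :: "real^5 \<Rightarrow> real^5" where
  "X1 x = vector [1, 0, 0, 0, 0]"

definition X2 :: "real^5 \<Rightarrow> real^5" where
  "X2 x = vector [0, 1, - x$1, (x$1)\<^sup>2 / 2, x$1 * x$2]"

text \<open>
  A closed half-space of \<open>V\<^sub>1 = span {X\<^sub>1, X\<^sub>2}\<close> bounded by a line through the origin, as a set
  of left-invariant vector fields.
\<close>

definition V1_half_space :: "((real^5 \<Rightarrow> real^5) set) \<Rightarrow> bool" where
  "V1_half_space W \<longleftrightarrow>
     (\<exists>\<alpha> \<beta> :: real. (\<alpha>, \<beta>) \<noteq> (0, 0) \<and>
        W = {(\<lambda>x. p *\<^sub>R X1 x + q *\<^sub>R X2 x) | p q. 0 \<le> \<alpha> * p + \<beta> * q})"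

lemma UNIV_5: "(UNIV :: 5 set) = {1, 2, 3, 4, 5}"
proof -
  have "i \<in> {1, 2, 3, 4, 5}" for i :: 5
  proof (induct i)
    case (of_int z)
    then have "z = 0 \<or> z = 1 \<or> z = 2 \<or> z = 3 \<or> z = 4" by simp arith
    then show ?case by auto
  qed
  then show ?thesis by auto
qed

lemma forall_5: "(\<forall>i::5. P i) \<longleftrightarrow> P 1 \<and> P 2 \<and> P 3 \<and> P 4 \<and> P 5"
  using UNIV_5 by (metis UNIV_I empty_iff insert_iff)

lemma vector_5 [simp]:
  "(vector [p, q, r, s, t] :: ('a::zero)^5) $ 1 = p"
  "(vector [p, q, r, s, t] :: ('a::zero)^5) $ 2 = q"
  "(vector [p, q, r, s, t] :: ('a::zero)^5) $ 3 = r"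
  "(vector [p, q, r, s, t] :: ('a::zero)^5) $ 4 = s"
  "(vector [p, q, r, s, t] :: ('a::zero)^5) $ 5 = t"
  unfolding vector_def by simp_all

lemma F23_mult_assoc: "(x \<odot> y) \<odot> z = x \<odot> (y \<odot> z)"
  by (simp add: vec_eq_iff forall_5 F23_mult_def field_simps power2_eq_square)

lemma F23_mult_zero [simp]: "0 \<odot> x = x" "x \<odot> 0 = x"
  by (simp_all add: vec_eq_iff forall_5 F23_mult_def)

lemma F23_second_kind:
  "x = F23_exp 5 (x$5) \<odot> F23_exp 4 (x$4) \<odot> F23_exp 3 (x$3) \<odot> F23_exp 2 (x$2) \<odot> F23_exp 1 (x$1)"
  by (simp add: vec_eq_iff forall_5 F23_mult_def F23_exp_def axis_def)

text \<open>\<open>X1\<close> and \<open>X2\<close> are the left-invariant fields with value \<open>e\<^sub>1\<close>, resp. \<open>e\<^sub>2\<close>, at the identity.\<close>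

lemma X1_left_invariant:
  "((\<lambda>t. x \<odot> F23_exp 1 t) has_vector_derivative X1 x) (at 0)"
proof -
  have "(\<lambda>t. x \<odot> F23_exp 1 t) = (\<lambda>t. x + t *\<^sub>R X1 x)"
    by (simp add: fun_eq_iff vec_eq_iff forall_5 F23_mult_def F23_exp_def axis_def X1_def)
  then show ?thesis
    by (auto intro!: derivative_eq_intros)
qed

lemma X2_left_invariant:
  "((\<lambda>t. x \<odot> F23_exp 2 t) has_vector_derivative X2 x) (at 0)"
proof -
  have "(\<lambda>t. x \<odot> F23_exp 2 t) = (\<lambda>t. x + t *\<^sub>R X2 x + t\<^sup>2 *\<^sub>R axis 5 (x$1 / 2))"
    by (simp add: fun_eq_iff vec_eq_iff forall_5 F23_mult_def F23_exp_def axis_def X2_def)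
  then show ?thesis
    by (auto intro!: derivative_eq_intros)
qed

definition partial_deriv :: "5 \<Rightarrow> (real^5 \<Rightarrow> real) \<Rightarrow> real^5 \<Rightarrow> real" where
  "partial_deriv i u x = frechet_derivative u (at x) (axis i 1)"

primrec C_k :: "nat \<Rightarrow> (real^5 \<Rightarrow> real) \<Rightarrow> bool" where
  "C_k 0 u \<longleftrightarrow> continuous_on UNIV u"
| "C_k (Suc k) u \<longleftrightarrow> u differentiable_on UNIV \<and> (\<forall>i. C_k k (partial_deriv i u))"

definition test_function :: "(real^5 \<Rightarrow> real) \<Rightarrow> bool" where
  "test_function u \<longleftrightarrow> (\<forall>k. C_k k u) \<and> compact (closure {x. u x \<noteq> 0})"

definition apply_field :: "(real^5 \<Rightarrow> real^5) \<Rightarrow> (real^5 \<Rightarrow> real) \<Rightarrow> real^5 \<Rightarrow> real" where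
  "apply_field X u x = frechet_derivative u (at x) (X x)"

text \<open>
  The Haar measure is Lebesgue measure in these coordinates. Left-invariant fields are
  divergence free, so \<open>- (\<integral>\<^sub>E X u)\<close> is the pairing of \<open>X 1\<^sub>E\<close> with \<open>u\<close>.
\<close>

definition constant_normal :: "(real^5) set \<Rightarrow> bool" where
  "constant_normal E \<longleftrightarrow>
     E \<in> sets lebesgue \<and>
     (\<exists>W. V1_half_space W \<and>
        (\<forall>X\<in>W. \<forall>u. test_function u \<and> (\<forall>x. 0 \<le> u x) \<longrightarrow>
           0 \<le> - (LINT x:E|lebesgue. apply_field X u x)))"

text \<open>On \<open>real^5\<close>, regularity of a locally finite Borel measure is automatic.\<close>

definition radon_measure :: "(real^5) measure \<Rightarrow> bool" where
  "radon_measure \<mu> \<longleftrightarrow> sets \<mu> = sets borel \<and> (\<forall>S. compact S \<longrightarrow> emeasure \<mu> S < \<infinity>)"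

text \<open>
  The distribution \<open>\<partial>\<^sub>i 1\<^sub>E\<close> is a (signed) Radon measure iff it is represented by
  \<open>\<mu> - \<nu>\<close> with positive Radon measures \<open>\<mu>\<close>, \<open>\<nu>\<close>, both of which may have infinite total mass.
\<close>

definition locally_finite_perimeter :: "(real^5) set \<Rightarrow> bool" where
  "locally_finite_perimeter E \<longleftrightarrow>
     (\<forall>i. \<exists>\<mu> \<nu>. radon_measure \<mu> \<and> radon_measure \<nu> \<and>
        (\<forall>u. test_function u \<longrightarrow>
           - (LINT x:E|lebesgue. partial_deriv i u x) = (LINT x|\<mu>. u x) - (LINT x|\<nu>. u x)))"

text \<open>A closed segment is the pair of its end points; \<open>l\<close> is the length of the removed part.\<close>

fun remove_middle :: "real \<Rightarrow> real \<times> real \<Rightarrow> (real \<times> real) list" where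
  "remove_middle l (p, q) = [(p, (p + q) / 2 - l / 2), ((p + q) / 2 + l / 2, q)]"

primrec cantor_segments :: "(nat \<Rightarrow> real) \<Rightarrow> nat \<Rightarrow> (real \<times> real) list" where
  "cantor_segments a 0 = remove_middle (a 0) (0, 1)"
| "cantor_segments a (Suc n) =
     concat (map (remove_middle (a (Suc n) / 2 ^ Suc n)) (cantor_segments a n))"

definition cantor_set :: "(nat \<Rightarrow> real) \<Rightarrow> real set" where
  "cantor_set a = (\<Inter>n. \<Union>(p, q)\<in>set (cantor_segments a n). {p..q})"

definition cone_C :: "(real^5) set" where
  "cone_C = {x. 0 \<le> x$2 \<and> 0 \<le> x$4 \<and> (x$5)\<^sup>2 \<le> 2 * (x$2) ^ 3 * x$4}"

end

theory Submission
  imports Defs "HOL-Computational_Algebra.Polynomial"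
begin

text \<open>
  A point \<open>x\<close> lies in \<open>E\<close> iff \<open>x\<^sub>2, x\<^sub>4 \<ge> 0\<close> and \<open>x\<^sub>5\<close> is within \<open>r = sqrt (2 x\<^sub>2\<^sup>3 x\<^sub>4)\<close> of \<open>K\<close>.
  Since \<open>E\<close> does not depend on \<open>x\<^sub>1\<close>, \<open>X\<^sub>1 1\<^sub>E = 0\<close>; and by Cauchy-Schwarz the measure-preserving flow
  \<open>x \<mapsto> x \<odot> exp (s X\<^sub>2)\<close>, \<open>s \<ge> 0\<close>, maps \<open>E\<close> into itself, hence \<open>X\<^sub>2 1\<^sub>E \<ge> 0\<close>.

  For the perimeter, let \<open>\<epsilon> = a\<^sub>n/2\<^sup>n\<close> be the length of the \<open>2\<^sup>n\<close> gaps of generation \<open>n\<close>. Where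
  \<open>r < \<epsilon>/2\<close>, each of these gaps contributes two jumps of \<open>1\<^sub>E\<close> in direction \<open>x\<^sub>5\<close>. In a bounded region
  this holds as long as \<open>x\<^sub>2\<close> is at most of order \<open>\<delta> = \<epsilon>\<^bsup>2/3\<^esup>\<close>, so \<open>\<partial>\<^sub>5 1\<^sub>E\<close> has there a variation of order at least
  \<open>2\<^sup>n \<delta> = (2\<^sup>n a\<^sub>n\<^sup>2)\<^bsup>1/3\<^esup>\<close>, which is unbounded. Bump functions placed in the gaps detect one jump each.
\<close>

section \<open>Lebesgue measure and shears\<close>

text \<open>By \<open>lborel_eq\<close> Lebesgue measure is the image of a product measure over
  \<open>Basis\<close>; peeling off the factor of \<open>b\<close> gives a Fubini form. It serves
  twice: for shears along \<open>b\<close>, and for slicing the set in the direction of x_5.\<close>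

lemma lborel_split_coordinate:
  fixes b :: "'a::euclidean_space"
  assumes b: "b \<in> Basis"
  defines "P \<equiv> \<lambda>(z, y). y *\<^sub>R b + (\<Sum>c\<in>Basis - {b}. z c *\<^sub>R c)"
  shows "P \<in> borel_measurable ((\<Pi>\<^sub>M c\<in>Basis - {b}. lborel) \<Otimes>\<^sub>M lborel)"
    and "lborel = distr ((\<Pi>\<^sub>M c\<in>Basis - {b}. lborel) \<Otimes>\<^sub>M lborel) borel P"
proof -
  interpret product_sigma_finite "\<lambda>_::'a. lborel :: real measure"
    by standard
  let ?I = "Basis - {b}" and ?S = "\<lambda>f. \<Sum>c\<in>Basis. f c *\<^sub>R c"
  have ins: "insert b ?I = Basis" using b by auto
  show P: "P \<in> borel_measurable ((\<Pi>\<^sub>M c\<in>?I. lborel) \<Otimes>\<^sub>M lborel)"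
    unfolding P_def by measurable
  have S: "?S (z(b := y)) = P (z, y)" for z y
    using b by (subst sum.remove[of _ b]) (auto simp: P_def intro!: sum.cong)
  have S_meas: "?S \<in> borel_measurable (\<Pi>\<^sub>M c\<in>Basis. lborel)" by measurable
  interpret pair_sigma_finite "\<Pi>\<^sub>M c\<in>?I. lborel :: real measure" "lborel :: real measure"
    by (intro pair_sigma_finite.intro sigma_finite lborel.sigma_finite_measure_axioms) simp
  show "lborel = distr ((\<Pi>\<^sub>M c\<in>?I. lborel) \<Otimes>\<^sub>M lborel) borel P"
  proof (rule measure_eqI)
    fix A :: "'a set" assume "A \<in> sets lborel"
    then have A: "A \<in> sets borel" by simp
    have [measurable]: "(indicator A :: _ \<Rightarrow> ennreal) \<in> borel_measurable borel"
      using A by simp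
    have "emeasure lborel A = (\<integral>\<^sup>+ x. indicator A x \<partial>distr (\<Pi>\<^sub>M c\<in>Basis. lborel) borel ?S)"
      using A by (subst lborel_eq) simp
    also have "\<dots> = (\<integral>\<^sup>+ f. indicator A (?S f) \<partial>Pi\<^sub>M (insert b ?I) (\<lambda>_. lborel))"
      using S_meas unfolding ins by (subst nn_integral_distr) auto
    also have "\<dots> = (\<integral>\<^sup>+ z. \<integral>\<^sup>+ y. indicator A (?S (z(b := y))) \<partial>lborel \<partial>(\<Pi>\<^sub>M c\<in>?I. lborel))"
      by (rule product_nn_integral_insert) (use S_meas in \<open>auto simp: ins\<close>)
    also have "\<dots> = (\<integral>\<^sup>+ z. \<integral>\<^sup>+ y. indicator A (P (z, y)) \<partial>lborel \<partial>(\<Pi>\<^sub>M c\<in>?I. lborel))"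
      unfolding S ..
    also have "\<dots> = (\<integral>\<^sup>+ x. indicator A (P x) \<partial>((\<Pi>\<^sub>M c\<in>?I. lborel) \<Otimes>\<^sub>M lborel))"
      using P by (subst lborel.nn_integral_fst) (auto simp: case_prod_unfold)
    also have "\<dots> = emeasure (distr ((\<Pi>\<^sub>M c\<in>?I. lborel) \<Otimes>\<^sub>M lborel) borel P) A"
      using P A by (subst nn_integral_distr[symmetric]) auto
    finally show "emeasure lborel A = emeasure (distr ((\<Pi>\<^sub>M c\<in>?I. lborel) \<Otimes>\<^sub>M lborel) borel P) A" .
  qed simp
qed

text \<open>On each line parallel to \<open>b\<close> the value of \<open>h\<close> is constant, so
  the shear acts there as a translation; translation invariance in one dimension and Fubini
  conclude.\<close>

lemma lborel_distr_shear:
  fixes b :: "'a::euclidean_space"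
  assumes b: "b \<in> Basis" and h [measurable]: "h \<in> borel_measurable borel"
    and inv: "\<And>x t. h (x + t *\<^sub>R b) = h x"
  shows "distr lborel borel (\<lambda>x. x + h x *\<^sub>R b) = lborel"
proof (rule measure_eqI)
  let ?I = "Basis - {b}"
  let ?P = "\<lambda>(z, y). y *\<^sub>R b + (\<Sum>c\<in>Basis - {b}. z c *\<^sub>R c)"
  let ?Z = "\<lambda>z::'a \<Rightarrow> real. \<Sum>c\<in>?I. z c *\<^sub>R c"
  let ?T = "\<lambda>x. x + h x *\<^sub>R b"
  note P [measurable] = lborel_split_coordinate(1)[OF b]
  note eq = lborel_split_coordinate(2)[OF b]
  fix A :: "'a set" assume "A \<in> sets (distr lborel borel ?T)"
  then have A: "A \<in> sets borel" by simp
  have [measurable]: "(indicator A :: _ \<Rightarrow> ennreal) \<in> borel_measurable borel"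
    using A by simp
  have split: "(\<integral>\<^sup>+ x. f x \<partial>lborel) = (\<integral>\<^sup>+ z. \<integral>\<^sup>+ y. f (?P (z, y)) \<partial>lborel \<partial>(\<Pi>\<^sub>M c\<in>?I. lborel))"
    if f [measurable]: "f \<in> borel_measurable borel" for f :: "'a \<Rightarrow> ennreal"
  proof -
    have "(\<integral>\<^sup>+ x. f x \<partial>lborel) = (\<integral>\<^sup>+ x. f (?P x) \<partial>((\<Pi>\<^sub>M c\<in>?I. lborel) \<Otimes>\<^sub>M lborel))"
      by (subst eq) (use P in \<open>simp add: nn_integral_distr\<close>)
    also have "\<dots> = (\<integral>\<^sup>+ z. \<integral>\<^sup>+ y. f (?P (z, y)) \<partial>lborel \<partial>(\<Pi>\<^sub>M c\<in>?I. lborel))"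
      using P by (subst lborel.nn_integral_fst) (auto simp: case_prod_unfold)
    finally show ?thesis .
  qed
  have T: "?T (?P (z, y)) = ?P (z, h (?Z z) + y)" for z y
    using inv[of "?Z z" y] by (simp add: algebra_simps)
  have "emeasure (distr lborel borel ?T) A = (\<integral>\<^sup>+ x. indicator A (?T x) \<partial>lborel)"
  proof -
    have "emeasure (distr lborel borel ?T) A = (\<integral>\<^sup>+ x. indicator A x \<partial>distr lborel borel ?T)"
      using A by simp
    then show ?thesis by (simp add: nn_integral_distr)
  qed
  also have "\<dots> = (\<integral>\<^sup>+ z. \<integral>\<^sup>+ y. indicator A (?T (?P (z, y))) \<partial>lborel \<partial>(\<Pi>\<^sub>M c\<in>?I. lborel))"
    by (rule split) measurable
  also have "\<dots> = (\<integral>\<^sup>+ z. \<integral>\<^sup>+ y. indicator A (?P (z, h (?Z z) + y)) \<partial>lborel \<partial>(\<Pi>\<^sub>M c\<in>?I. lborel))"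
    unfolding T ..
  also have "\<dots> = (\<integral>\<^sup>+ z. \<integral>\<^sup>+ y. indicator A (?P (z, y)) \<partial>lborel \<partial>(\<Pi>\<^sub>M c\<in>?I. lborel))"
  proof (rule nn_integral_cong)
    fix z
    have "(\<integral>\<^sup>+ y. indicator A (?P (z, y)) \<partial>lborel)
        = (\<integral>\<^sup>+ y. indicator A (?P (z, y)) \<partial>distr lborel borel ((+) (h (?Z z))))"
      by (simp add: lborel_distr_plus)
    also have "\<dots> = (\<integral>\<^sup>+ y. indicator A (?P (z, h (?Z z) + y)) \<partial>lborel)"
      by (subst nn_integral_distr) auto
    finally show "(\<integral>\<^sup>+ y. indicator A (?P (z, h (?Z z) + y)) \<partial>lborel)
        = (\<integral>\<^sup>+ y. indicator A (?P (z, y)) \<partial>lborel)" ..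
  qed
  also have "\<dots> = (\<integral>\<^sup>+ x. indicator A x \<partial>lborel)"
    by (rule split[symmetric]) measurable
  also have "\<dots> = emeasure lborel A" using A by simp
  finally show "emeasure (distr lborel borel ?T) A = emeasure lborel A" .
qed simp

section \<open>Transport along measure-preserving flows\<close>

text \<open>Reduces continuity of \<open>apply_field X u\<close> to continuity of the partial
  derivatives, which is what \<open>C_k\<close> provides.\<close>

lemma frechet_derivative_coordinates:
  fixes u :: "real^5 \<Rightarrow> real"
  assumes "u differentiable (at x)"
  shows "frechet_derivative u (at x) v = (\<Sum>i\<in>UNIV. v $ i * partial_deriv i u x)"
proof -
  have lin: "linear (frechet_derivative u (at x))"
    using assms by (rule linear_frechet_derivative)
  have "frechet_derivative u (at x) v = frechet_derivative u (at x) (\<Sum>i\<in>UNIV. v $ i *\<^sub>R axis i 1)"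
    by (simp add: basis_expansion flip: scalar_mult_eq_scaleR)
  then show ?thesis
    by (simp add: linear_sum[OF lin] linear_scale[OF lin] partial_deriv_def)
qed

lemma test_function_C1:
  assumes "test_function u"
  shows "u differentiable (at x)" "continuous_on UNIV (partial_deriv i u)" "continuous_on UNIV u"
    "compact (closure {x. u x \<noteq> 0})"
proof -
  have "C_k (Suc 0) u" "C_k 0 u" and *: "compact (closure {x. u x \<noteq> 0})"
    using assms by (auto simp only: test_function_def)
  then show "u differentiable (at x)" "continuous_on UNIV (partial_deriv i u)" "continuous_on UNIV u"
    by (auto simp: differentiable_on_def)
  show "compact (closure {x. u x \<noteq> 0})" by (rule *)
qed

lemma frechet_derivative_outside_support:
  fixes u :: "real^5 \<Rightarrow> real"
  assumes "x \<notin> closure {x. u x \<noteq> 0}"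
  shows "frechet_derivative u (at x) = (\<lambda>_. 0)"
proof -
  have "((\<lambda>_. 0) has_derivative (\<lambda>_. 0 :: real)) (at x)" by simp
  then have "(u has_derivative (\<lambda>_. 0)) (at x)"
  proof (rule has_derivative_transform_within_open[where s = "- closure {x. u x \<noteq> 0}"])
    fix y assume "y \<in> - closure {x. u x \<noteq> 0}"
    then show "0 = u y" using closure_subset[of "{x. u x \<noteq> 0}"] by auto
  qed (use assms in auto)
  then show ?thesis by (rule frechet_derivative_at[symmetric])
qed

lemma integrable_continuous_compact_support:
  fixes f :: "'a::euclidean_space \<Rightarrow> real"
  assumes "continuous_on UNIV f" "compact S" "\<And>x. x \<notin> S \<Longrightarrow> f x = 0"
  shows "integrable lborel f"
proof -
  have "integrable lborel (\<lambda>x. indicator S x *\<^sub>R f x)"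
    using assms by (intro borel_integrable_compact) (auto intro: continuous_on_subset)
  moreover have "(\<lambda>x. indicator S x *\<^sub>R f x) = f"
    using assms(3) by (auto simp: fun_eq_iff indicator_def)
  ultimately show ?thesis by simp
qed

lemma set_integral_lebesgue_eq_lborel:
  fixes f :: "'a::euclidean_space \<Rightarrow> real"
  assumes "E \<in> sets borel" "f \<in> borel_measurable borel"
  shows "(LINT x:E|lebesgue. f x) = (LINT x|lborel. indicator E x * f x)"
  unfolding set_lebesgue_integral_def using assms by (simp add: integral_completion)

text \<open>
  Transporting \<open>E\<close> into itself by a measure-preserving flow makes \<open>s \<mapsto> \<integral>\<^sub>E u \<circ> \<Phi> s\<close> maximal at
  \<open>s = 0\<close>, and its derivative there is \<open>\<integral>\<^sub>E X u\<close>.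
\<close>

lemma integral_field_nonpos:
  fixes \<Phi> :: "real \<Rightarrow> real^5 \<Rightarrow> real^5"
  assumes u: "test_function u" "\<And>x. 0 \<le> u x"
    and E: "E \<in> sets borel"
    and X: "continuous_on UNIV X"
    and zero: "\<And>x. \<Phi> 0 x = x"
    and inv: "\<And>s x. \<Phi> (- s) (\<Phi> s x) = x"
    and deriv: "\<And>s x. ((\<lambda>s. \<Phi> s x) has_vector_derivative X (\<Phi> s x)) (at s)"
    and cont: "continuous_on UNIV (\<lambda>(s, x). \<Phi> s x)"
    and meas: "\<And>s. distr lborel borel (\<Phi> s) = lborel"
    and into: "\<And>s x. 0 \<le> s \<Longrightarrow> x \<in> E \<Longrightarrow> \<Phi> s x \<in> E"
  shows "(LINT x|lborel. indicator E x * apply_field X u x) \<le> 0"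
proof -
  let ?S = "closure {x. u x \<noteq> 0}" and ?U = "apply_field X u"
  note [measurable] = E
  have cont_u: "continuous_on UNIV u" and comp: "compact ?S" using u test_function_C1 by blast+
  have U_eq: "?U = (\<lambda>x. \<Sum>i\<in>UNIV. X x $ i * partial_deriv i u x)"
    using frechet_derivative_coordinates test_function_C1(1)[OF u(1)] by (auto simp: apply_field_def)
  have cont_U: "continuous_on UNIV ?U"
    unfolding U_eq by (intro continuous_intros X test_function_C1(2)[OF u(1)])
  have U_outside: "?U x = 0" if "x \<notin> ?S" for x
    using frechet_derivative_outside_support[OF that] by (simp add: apply_field_def)
  have u_outside: "u x = 0" if "x \<notin> ?S" for x
    using that closure_subset[of "{x. u x \<noteq> 0}"] by auto
  have "compact (?U ` ?S)"
    using cont_U comp by (intro compact_continuous_image) (auto intro: continuous_on_subset)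
  then obtain M where M: "0 < M" "\<And>x. x \<in> ?S \<Longrightarrow> norm (?U x) \<le> M"
    using compact_imp_bounded[of "?U ` ?S"] unfolding bounded_pos by auto
  have M_all: "norm (?U x) \<le> M" for x
    using M U_outside[of x] by (cases "x \<in> ?S") auto
  \<comment> \<open>All backward trajectories of duration at most 1 that start in the support. A
    point outside \<open>B\<close> does not reach the support within time 1, so \<open>B\<close>
    carries all the difference quotients below at once.\<close>
  define B where "B = (\<lambda>(s, x). \<Phi> s x) ` ({-1..0} \<times> ?S)"
  have B: "compact B"
    unfolding B_def using comp
    by (intro compact_continuous_image continuous_on_subset[OF cont] compact_Times) auto
  have B_mem: "x \<in> B" if "0 \<le> s" "s \<le> 1" "\<Phi> s x \<in> ?S" for s x
    unfolding B_def using that inv[of s x] by (intro image_eqI[of _ _ "(- s, \<Phi> s x)"]) auto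
  have cont_\<Phi>: "continuous_on UNIV (\<Phi> s)" for s
    using continuous_on_compose2[OF cont, of UNIV "\<lambda>x. (s, x)"] by (simp add: continuous_on_Pair)
  then have \<Phi>_meas [measurable]: "\<Phi> s \<in> borel_measurable borel" for s
    by (rule borel_measurable_continuous_onI)
  have u_meas [measurable]: "u \<in> borel_measurable borel"
    using cont_u by (rule borel_measurable_continuous_onI)
  have U_meas [measurable]: "?U \<in> borel_measurable borel"
    using cont_U by (rule borel_measurable_continuous_onI)
  have der: "((\<lambda>s. u (\<Phi> s x)) has_real_derivative ?U (\<Phi> s x)) (at s)" for s x
  proof -
    let ?D = "frechet_derivative u (at (\<Phi> s x))"
    have "(u has_derivative ?D) (at (\<Phi> s x))"
      using test_function_C1(1)[OF u(1)] by (simp add: frechet_derivative_works)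
    then have "((u \<circ> (\<lambda>s. \<Phi> s x)) has_derivative (?D \<circ> (\<lambda>h. h *\<^sub>R X (\<Phi> s x)))) (at s)"
      using deriv[of x s] unfolding has_vector_derivative_def by (intro diff_chain_at)
    moreover have "?D \<circ> (\<lambda>h. h *\<^sub>R X (\<Phi> s x)) = (*) (?U (\<Phi> s x))"
      using linear_frechet_derivative[OF test_function_C1(1)[OF u(1)]]
      by (auto simp: apply_field_def linear_scale fun_eq_iff)
    ultimately show ?thesis
      by (simp add: has_field_derivative_def comp_def)
  qed
  \<comment> \<open>Dominated convergence works along sequences, so the derivative at time 0 is
    taken along the times 1/(n+1), which stay in the range covered by \<open>B\<close>.\<close>
  define s where "s n = 1 / real (Suc n)" for n
  have s: "0 < s n" "s n \<le> 1" for n by (simp_all add: s_def)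
  have s_lim: "filterlim s (at 0) sequentially"
    unfolding filterlim_at s_def using LIMSEQ_inverse_real_of_nat by (auto simp: inverse_eq_divide)
  define D where "D n x = (u (\<Phi> (s n) x) - u x) / s n" for n x
  have D_meas [measurable]: "D n \<in> borel_measurable borel" for n
    unfolding D_def by measurable
  have D_lim: "(\<lambda>n. D n x) \<longlonglongrightarrow> ?U x" for x
    unfolding D_def
    using filterlim_compose[OF der[where s=0, unfolded DERIV_def] s_lim, of x] by (simp add: zero)
  have D_bound: "norm (D n x) \<le> M * indicator B x" for n x
  proof -
    \<comment> \<open>The mean value theorem turns the quotient into a value of \<open>?U\<close> at
      an intermediate time; this gives both the bound \<open>M\<close> and the vanishing off
      \<open>B\<close>.\<close>
    obtain \<xi> where \<xi>: "0 < \<xi>" "\<xi> < s n" "u (\<Phi> (s n) x) - u (\<Phi> 0 x) = (s n - 0) * ?U (\<Phi> \<xi> x)"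
      using MVT2[OF s(1)[of n], of "\<lambda>s. u (\<Phi> s x)" "\<lambda>s. ?U (\<Phi> s x)"] der by blast
    then have D: "D n x = ?U (\<Phi> \<xi> x)" using s(1)[of n] by (simp add: D_def zero)
    show ?thesis
    proof (cases "x \<in> B")
      case False
      then have "\<Phi> \<xi> x \<notin> ?S" using B_mem[of \<xi> x] \<xi> s(2)[of n] by fastforce
      then show ?thesis using False U_outside D by simp
    qed (use M_all D in simp)
  qed
  have int_u: "integrable lborel u"
    using cont_u comp u_outside by (rule integrable_continuous_compact_support)
  have int_u\<Phi>: "integrable lborel (\<lambda>x. f (\<Phi> r x))"
    and lint_u\<Phi>: "(LINT x|lborel. f (\<Phi> r x)) = (LINT x|lborel. f x)"
    if f: "integrable lborel f" for r and f :: "real^5 \<Rightarrow> real"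
  proof -
    have [measurable]: "f \<in> borel_measurable borel" using f by auto
    have "\<Phi> r \<in> measurable lborel borel" by simp
    then show "integrable lborel (\<lambda>x. f (\<Phi> r x))"
      by (rule integrable_distr) (simp add: meas f)
    have "(LINT x|lborel. f x) = (LINT x|distr lborel borel (\<Phi> r). f x)" by (simp add: meas)
    also have "\<dots> = (LINT x|lborel. f (\<Phi> r x))" by (rule integral_distr) auto
    finally show "(LINT x|lborel. f (\<Phi> r x)) = (LINT x|lborel. f x)" ..
  qed
  have int_ind: "integrable lborel (\<lambda>x. indicator E x * f x)"
    if "integrable lborel f" for f :: "real^5 \<Rightarrow> real"
    using integrable_mult_indicator[of E lborel f] that E by simp
  have D_nonpos: "(LINT x|lborel. indicator E x * D n x) \<le> 0" for n
  proof -
    \<comment> \<open>Forward invariance of \<open>E\<close> and nonnegativity of \<open>u\<close>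
      give the inequality; measure preservation then removes the flow from its right side.\<close>
    have "(LINT x|lborel. indicator E x * u (\<Phi> (s n) x))
        \<le> (LINT x|lborel. indicator E (\<Phi> (s n) x) * u (\<Phi> (s n) x))"
    proof (rule integral_mono)
      show "integrable lborel (\<lambda>x. indicator E (\<Phi> (s n) x) * u (\<Phi> (s n) x))"
        by (rule int_u\<Phi>) (intro int_ind int_u)
      show "indicator E x * u (\<Phi> (s n) x) \<le> indicator E (\<Phi> (s n) x) * u (\<Phi> (s n) x)" for x
        using into[of "s n" x] s(1)[of n] u(2) by (auto simp: indicator_def)
    qed (intro int_ind int_u\<Phi> int_u)
    also have "\<dots> = (LINT x|lborel. indicator E x * u x)"
      by (rule lint_u\<Phi>) (intro int_ind int_u)
    finally have le: "(LINT x|lborel. indicator E x * u (\<Phi> (s n) x)) \<le> \<dots>" .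
    have "(LINT x|lborel. indicator E x * D n x)
        = (LINT x|lborel. (indicator E x * u (\<Phi> (s n) x) - indicator E x * u x) / s n)"
      by (simp add: D_def algebra_simps)
    also have "\<dots> = ((LINT x|lborel. indicator E x * u (\<Phi> (s n) x)) - (LINT x|lborel. indicator E x * u x)) / s n"
      by (simp add: Bochner_Integration.integral_diff int_ind int_u\<Phi> int_u)
    also have "\<dots> \<le> 0" using le s(1)[of n] by (intro divide_nonpos_pos) simp_all
    finally show ?thesis .
  qed
  have "(\<lambda>n. LINT x|lborel. indicator E x * D n x) \<longlonglongrightarrow> (LINT x|lborel. indicator E x * ?U x)"
  proof (rule integral_dominated_convergence)
    show "integrable lborel (\<lambda>x. M * indicator B x)"
      using B by (intro integrable_mult_right integrable_real_indicator)
        (use emeasure_compact_finite[OF B] in \<open>auto simp: borel_compact\<close>)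
    show "AE x in lborel. (\<lambda>n. indicator E x * D n x) \<longlonglongrightarrow> indicator E x * ?U x"
      by (intro AE_I2 tendsto_mult_left D_lim)
    have "norm (indicator E x * D n x) \<le> norm (D n x)" for x n by (simp add: indicator_def)
    then show "AE x in lborel. norm (indicator E x * D n x) \<le> M * indicator B x" for n
      using D_bound order_trans by (intro AE_I2) blast
  qed auto
  then show ?thesis
    by (rule LIMSEQ_le_const2) (use D_nonpos in blast)
qed

section \<open>The union of translated cones\<close>

lemma distr_lborel_compose:
  assumes "f \<in> borel_measurable borel" "g \<in> borel_measurable borel"
    and "distr lborel borel f = lborel" "distr lborel borel g = lborel"
  shows "distr lborel borel (\<lambda>x. g (f x)) = (lborel :: 'a::euclidean_space measure)"
proof -
  have "distr lborel borel (\<lambda>x. g (f x)) = distr (distr lborel borel f) borel g"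
    using assms(1,2) by (subst distr_distr) (auto simp: comp_def)
  then show ?thesis using assms(3,4) by simp
qed

section \<open>Flows of \<open>X1\<close> and \<open>X2\<close> and invariance of Lebesgue measure
  under them\<close>

lemma mult_exp1: "x \<odot> F23_exp 1 s = x + s *\<^sub>R axis 1 1"
  by (simp add: vec_eq_iff forall_5 F23_mult_def F23_exp_def axis_def)

text \<open>The sum of axis vectors displays right multiplication as a composition of coordinate
  shears.\<close>

lemma mult_exp2:
  "x \<odot> F23_exp 2 s = x + s *\<^sub>R axis 2 1 + (- x$1 * s) *\<^sub>R axis 3 1
     + ((x$1)\<^sup>2 * s / 2) *\<^sub>R axis 4 1 + (x$1 * x$2 * s + x$1 * s\<^sup>2 / 2) *\<^sub>R axis 5 1"
  by (simp add: vec_eq_iff forall_5 F23_mult_def F23_exp_def axis_def)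

lemma X1_eq: "X1 x = axis 1 1"
  by (simp add: vec_eq_iff forall_5 X1_def axis_def)

lemma X2_eq:
  "X2 x = axis 2 1 + (- x$1) *\<^sub>R axis 3 1 + ((x$1)\<^sup>2 / 2) *\<^sub>R axis 4 1 + (x$1 * x$2) *\<^sub>R axis 5 1"
  by (simp add: vec_eq_iff forall_5 X2_def axis_def)

lemma distr_lborel_coordinate_shear:
  fixes h :: "real^5 \<Rightarrow> real"
  assumes "continuous_on UNIV h" "\<And>x t. h (x + t *\<^sub>R axis i 1) = h x"
  shows "distr lborel borel (\<lambda>x. x + h x *\<^sub>R axis i 1) = lborel"
    and "(\<lambda>x. x + h x *\<^sub>R axis i 1) \<in> borel_measurable borel"
proof -
  have h [measurable]: "h \<in> borel_measurable borel"
    using assms(1) by (rule borel_measurable_continuous_onI)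
  show "distr lborel borel (\<lambda>x. x + h x *\<^sub>R axis i 1) = lborel"
    using assms(2) by (intro lborel_distr_shear h) (simp_all add: axis_in_Basis_iff)
  show "(\<lambda>x. x + h x *\<^sub>R axis i 1) \<in> borel_measurable borel" by measurable
qed

lemma distr_mult_exp1: "distr lborel borel (\<lambda>x. x \<odot> F23_exp 1 s) = lborel"
  using distr_lborel_coordinate_shear(1)[of "\<lambda>_. s" 1] by (simp add: mult_exp1)

lemma distr_mult_exp2: "distr lborel borel (\<lambda>x. x \<odot> F23_exp 2 s) = lborel"
proof -
  \<comment> \<open>The shears are applied from \<open>T5\<close> down to \<open>T2\<close>:
    \<open>T5\<close> must read x_2 before \<open>T2\<close> changes it, and x_1 is never changed.
    No coefficient involves the coordinate moved by its own shear.\<close>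
  define T5 :: "real^5 \<Rightarrow> real^5" where "T5 x = x + (x$1 * x$2 * s + x$1 * s\<^sup>2 / 2) *\<^sub>R axis 5 1" for x
  define T4 :: "real^5 \<Rightarrow> real^5" where "T4 x = x + ((x$1)\<^sup>2 * s / 2) *\<^sub>R axis 4 1" for x
  define T3 :: "real^5 \<Rightarrow> real^5" where "T3 x = x + (- x$1 * s) *\<^sub>R axis 3 1" for x
  define T2 :: "real^5 \<Rightarrow> real^5" where "T2 x = x + s *\<^sub>R axis 2 1" for x
  have T5: "distr lborel borel T5 = lborel" "T5 \<in> borel_measurable borel"
    unfolding T5_def[abs_def]
    by (rule distr_lborel_coordinate_shear; auto intro!: continuous_intros simp: axis_def)+
  have T4: "distr lborel borel T4 = lborel" "T4 \<in> borel_measurable borel"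
    unfolding T4_def[abs_def]
    by (rule distr_lborel_coordinate_shear; auto intro!: continuous_intros simp: axis_def)+
  have T3: "distr lborel borel T3 = lborel" "T3 \<in> borel_measurable borel"
    unfolding T3_def[abs_def]
    by (rule distr_lborel_coordinate_shear; auto intro!: continuous_intros simp: axis_def)+
  have T2: "distr lborel borel T2 = lborel" "T2 \<in> borel_measurable borel"
    unfolding T2_def[abs_def]
    by (rule distr_lborel_coordinate_shear; auto intro!: continuous_intros simp: axis_def)+
  have eq: "x \<odot> F23_exp 2 s = T2 (T3 (T4 (T5 x)))" for x
    by (simp add: vec_eq_iff forall_5 mult_exp2 T5_def T4_def T3_def T2_def axis_def)
  note T45 = distr_lborel_compose[OF T5(2) T4(2) T5(1) T4(1)] measurable_compose[OF T5(2) T4(2)]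
  note T345 = distr_lborel_compose[OF T45(2) T3(2) T45(1) T3(1)] measurable_compose[OF T45(2) T3(2)]
  show ?thesis
    unfolding eq using T345(2) T2(2) T345(1) T2(1) by (rule distr_lborel_compose)
qed

text \<open>By Cauchy-Schwarz the left side is at most \<open>(d + p\<^sup>2 s/2) (z\<^sup>2/d + 2 s (b + s/2)\<^sup>2)\<close>.\<close>

lemma cone_inequality:
  fixes p b d s z :: real
  assumes "0 \<le> b" "0 \<le> d" "0 \<le> s" and z: "z\<^sup>2 \<le> 2 * b ^ 3 * d"
  shows "(z + p * b * s + p * s\<^sup>2 / 2)\<^sup>2 \<le> 2 * (b + s) ^ 3 * (d + p\<^sup>2 * s / 2)"
proof -
  let ?A = "d + p\<^sup>2 * s / 2" and ?B = "2 * b ^ 3 + 2 * s * (b + s / 2)\<^sup>2"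
  have "0 \<le> ?A" using assms by simp
  have B: "?B \<le> 2 * (b + s) ^ 3"
  proof -
    have "2 * (b + s) ^ 3 - ?B = 4 * b\<^sup>2 * s + 4 * b * s\<^sup>2 + 3 / 2 * s ^ 3"
      by (simp add: power2_eq_square power3_eq_cube field_simps)
    also have "\<dots> \<ge> 0" using assms by simp
    finally show ?thesis by simp
  qed
  have "(z + p * b * s + p * s\<^sup>2 / 2)\<^sup>2 \<le> ?A * ?B"
  proof -
    \<comment> \<open>With these names \<open>?A * ?B\<close> expands to 2 b^3 d + (m + n) + y^2,
      and the left side is (z + y)^2. It remains to bound the cross term 2 z y by m + n, which
      follows from (2 z y)^2 <= 4 m n <= (m + n)^2.\<close>
    define c where "c = b + s / 2"
    define y where "y = p * s * c"
    define m where "m = 2 * d * s * c\<^sup>2"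
    define n where "n = p\<^sup>2 * s * b ^ 3"
    have y2: "y\<^sup>2 = p\<^sup>2 * s\<^sup>2 * c\<^sup>2" by (simp add: y_def power_mult_distrib)
    have "(2 * z * y)\<^sup>2 = z\<^sup>2 * (4 * y\<^sup>2)" by (simp add: power_mult_distrib)
    also have "\<dots> \<le> (2 * b ^ 3 * d) * (4 * y\<^sup>2)" by (intro mult_right_mono z) simp
    also have "\<dots> = 4 * m * n" unfolding y2 m_def n_def by (simp add: power2_eq_square)
    also have "\<dots> \<le> (m + n)\<^sup>2"
      using zero_le_power2[of "m - n"] by (simp add: power2_diff power2_sum)
    finally have "2 * z * y \<le> m + n"
      by (rule power2_le_imp_le) (use assms in \<open>simp add: m_def n_def\<close>)
    then have "(z + y)\<^sup>2 \<le> 2 * b ^ 3 * d + (m + n) + y\<^sup>2" using z by (simp add: power2_sum)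
    moreover have "z + p * b * s + p * s\<^sup>2 / 2 = z + y"
      by (simp add: y_def c_def field_simps power2_eq_square)
    moreover have "?A * ?B = 2 * b ^ 3 * d + (m + n) + y\<^sup>2"
      unfolding y2 m_def n_def c_def[symmetric] by (simp add: field_simps power2_eq_square)
    ultimately show ?thesis by (simp only:)
  qed
  also have "\<dots> \<le> ?A * (2 * (b + s) ^ 3)" using B \<open>0 \<le> ?A\<close> by (rule mult_left_mono)
  finally show ?thesis by (simp add: mult.commute)
qed

text \<open>The set \<open>E\<close> of the theorem with an arbitrary \<open>K\<close>: constant
  normal is proved for every compact \<open>K\<close>, and the Cantor structure enters with the
  perimeter.\<close>

definition cone_union :: "real set \<Rightarrow> (real^5) set" where
  "cone_union K = (\<Union>t\<in>K. left_translation (F23_exp 5 t) ` cone_C)"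

lemma left_translation_exp5: "left_translation (F23_exp 5 t) x = x + t *\<^sub>R axis 5 1"
  by (simp add: vec_eq_iff forall_5 left_translation_def F23_mult_def F23_exp_def axis_def)

text \<open>Left translation by \<open>F23_exp 5 t\<close> only shifts x_5, so for x_2, x_4 >= 0 the
  slice in the direction of x_5 is a union of intervals of one common radius centred in
  \<open>K\<close>.\<close>

lemma cone_union_iff:
  "x \<in> cone_union K \<longleftrightarrow> 0 \<le> x$2 \<and> 0 \<le> x$4 \<and> (\<exists>t\<in>K. (x$5 - t)\<^sup>2 \<le> 2 * (x$2) ^ 3 * x$4)"
proof -
  have "x \<in> left_translation (F23_exp 5 t) ` cone_C \<longleftrightarrow> x - t *\<^sub>R axis 5 1 \<in> cone_C" for t
    unfolding left_translation_exp5 by (auto intro!: image_eqI[of _ _ "x - t *\<^sub>R axis 5 1"])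
  then show ?thesis by (auto simp: cone_union_def cone_C_def axis_def)
qed

text \<open>The union is the sum of the closed cone and a compact subset of the x_5 axis, and such
  sums are closed.\<close>

lemma closed_cone_union:
  assumes "compact K"
  shows "closed (cone_union K)"
proof -
  have "closed cone_C"
    unfolding cone_C_def by (intro closed_Collect_conj closed_Collect_le continuous_intros)
  moreover have "compact ((\<lambda>t. t *\<^sub>R axis 5 1 :: real^5) ` K)"
    by (intro compact_continuous_image continuous_intros assms)
  ultimately have "closed (\<Union>x\<in>cone_C. \<Union>y\<in>(\<lambda>t. t *\<^sub>R axis 5 1) ` K. {x + y})"
    by (rule closed_compact_sums)
  moreover have "(\<Union>x\<in>cone_C. \<Union>y\<in>(\<lambda>t. t *\<^sub>R axis 5 1) ` K. {x + y}) = cone_union K"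
    by (auto simp: cone_union_def left_translation_exp5)
  ultimately show ?thesis by simp
qed

text \<open>Left and right translations commute, so the witness \<open>t\<close> can stay fixed: the
  claim is \<open>cone_inequality\<close> for z = x_5 - t, p = x_1, b = x_2, d = x_4.\<close>

lemma cone_union_mult_exp2:
  assumes "x \<in> cone_union K" "0 \<le> s"
  shows "x \<odot> F23_exp 2 s \<in> cone_union K"
proof -
  obtain t where t: "t \<in> K" "(x$5 - t)\<^sup>2 \<le> 2 * (x$2) ^ 3 * x$4" and pos: "0 \<le> x$2" "0 \<le> x$4"
    using assms(1) by (auto simp: cone_union_iff)
  have "(x$5 - t + x$1 * x$2 * s + x$1 * s\<^sup>2 / 2)\<^sup>2 \<le> 2 * (x$2 + s) ^ 3 * (x$4 + (x$1)\<^sup>2 * s / 2)"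
    using pos assms(2) t(2) by (rule cone_inequality)
  then show ?thesis
    using t(1) pos assms(2)
    by (auto simp: cone_union_iff mult_exp2 axis_def algebra_simps intro!: bexI[of _ t])
qed

lemma cone_union_add_axis1: "x + s *\<^sub>R axis 1 1 \<in> cone_union K \<longleftrightarrow> x \<in> cone_union K"
  by (simp add: cone_union_iff axis_def)

lemma exp_inverse: "F23_exp i s \<odot> F23_exp i (- s) = 0" if "i = 1 \<or> i = 2"
  using that by (auto simp: vec_eq_iff forall_5 F23_mult_def F23_exp_def axis_def)

text \<open>Membership does not depend on x_1, so multiples of \<open>X1\<close> of either sign
  qualify, whereas the flow of \<open>X2\<close> is used forwards in time. This dictates the
  half-space q >= 0, and linearity combines the two estimates.\<close>

lemma constant_normal_cone_union:
  assumes "compact K"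
  shows "constant_normal (cone_union K)"
proof -
  let ?E = "cone_union K"
  let ?W = "{(\<lambda>x. p *\<^sub>R X1 x + q *\<^sub>R X2 x) | p q. 0 \<le> 0 * p + 1 * q} :: (real^5 \<Rightarrow> real^5) set"
  have E: "?E \<in> sets borel" using closed_cone_union[OF assms] by simp
  have X1_cont: "continuous_on UNIV X1" "continuous_on UNIV X2"
    by (auto simp: X1_eq[abs_def] X2_eq[abs_def] intro!: continuous_intros)
  have "0 \<le> - (LINT x:?E|lebesgue. apply_field (\<lambda>x. p *\<^sub>R X1 x + q *\<^sub>R X2 x) u x)"
    if q: "0 \<le> q" and u: "test_function u" "\<And>x. 0 \<le> u x" for p q u
  proof -
    \<comment> \<open>The flow of \<open>X1\<close> is run at an arbitrary real speed
      \<open>\<sigma>\<close>, so that negative p are covered as well.\<close>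
    have 1: "(LINT x|lborel. indicator ?E x * apply_field (\<lambda>x. \<sigma> *\<^sub>R X1 x) u x) \<le> 0" for \<sigma>
    proof (rule integral_field_nonpos[where \<Phi> = "\<lambda>s x. x + (\<sigma> * s) *\<^sub>R axis 1 1", OF u E])
      show "((\<lambda>s. x + (\<sigma> * s) *\<^sub>R axis 1 1) has_vector_derivative \<sigma> *\<^sub>R X1 (x + (\<sigma> * s) *\<^sub>R axis 1 1)) (at s)" for s x
        by (auto intro!: derivative_eq_intros simp: X1_eq)
      show "continuous_on UNIV (\<lambda>(s, x). x + (\<sigma> * s) *\<^sub>R axis 1 1 :: real^5)"
        by (auto simp: case_prod_unfold intro!: continuous_intros)
      show "distr lborel borel (\<lambda>x. x + (\<sigma> * s) *\<^sub>R axis 1 1 :: real^5) = lborel" for s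
        using distr_mult_exp1[of "\<sigma> * s"] by (simp add: mult_exp1)
    qed (auto simp: cone_union_add_axis1 X1_eq)
    have 2: "(LINT x|lborel. indicator ?E x * apply_field X2 u x) \<le> 0"
    proof (rule integral_field_nonpos[where \<Phi> = "\<lambda>s x. x \<odot> F23_exp 2 s", OF u E X1_cont(2)])
      show "((\<lambda>s. x \<odot> F23_exp 2 s) has_vector_derivative X2 (x \<odot> F23_exp 2 s)) (at s)" for s x
        unfolding mult_exp2 X2_eq
        by (auto intro!: derivative_eq_intros
            simp: axis_def vec_eq_iff forall_5 algebra_simps power2_eq_square)
      show "continuous_on UNIV (\<lambda>(s, x). x \<odot> F23_exp 2 s)"
        by (auto simp: case_prod_unfold mult_exp2 intro!: continuous_intros)
      show "x \<odot> F23_exp 2 s \<odot> F23_exp 2 (- s) = x" for s x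
        by (simp add: F23_mult_assoc exp_inverse)
      show "x \<odot> F23_exp 2 0 = x" for x by (simp add: mult_exp2)
    qed (auto simp: cone_union_mult_exp2 distr_mult_exp2)
    note d = test_function_C1[OF u(1)]
    have af: "apply_field X u x = (\<Sum>i\<in>UNIV. X x $ i * partial_deriv i u x)" for X x
      using frechet_derivative_coordinates[OF d(1)] by (simp add: apply_field_def)
    have int: "integrable lborel (\<lambda>x. indicator ?E x * apply_field X u x)"
      if "continuous_on UNIV X" for X
    proof -
      have "integrable lborel (apply_field X u)"
        using d(4)
      proof (rule integrable_continuous_compact_support[rotated])
        show "continuous_on UNIV (apply_field X u)"
          unfolding af[abs_def] by (intro continuous_intros that d)
        show "apply_field X u x = 0" if "x \<notin> closure {x. u x \<noteq> 0}" for x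
          using frechet_derivative_outside_support[OF that] by (simp add: apply_field_def)
      qed
      then show ?thesis using integrable_mult_indicator[of ?E lborel "apply_field X u"] E by simp
    qed
    have meas: "(LINT x:?E|lebesgue. apply_field X u x) = (LINT x|lborel. indicator ?E x * apply_field X u x)"
      if "continuous_on UNIV X" for X
      using E by (rule set_integral_lebesgue_eq_lborel)
        (auto intro!: borel_measurable_continuous_onI continuous_intros that d simp: af[abs_def])
    have "(LINT x:?E|lebesgue. apply_field (\<lambda>x. p *\<^sub>R X1 x + q *\<^sub>R X2 x) u x)
        = (LINT x|lborel. indicator ?E x * apply_field (\<lambda>x. p *\<^sub>R X1 x + q *\<^sub>R X2 x) u x)"
      by (intro meas continuous_intros X1_cont)
    also have "\<dots> = (LINT x|lborel. indicator ?E x * apply_field (\<lambda>x. p *\<^sub>R X1 x) u x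
        + q * (indicator ?E x * apply_field X2 u x))"
      by (simp add: af sum_distrib_left sum.distrib algebra_simps)
    also have "\<dots> = (LINT x|lborel. indicator ?E x * apply_field (\<lambda>x. p *\<^sub>R X1 x) u x)
        + q * (LINT x|lborel. indicator ?E x * apply_field X2 u x)"
      by (subst Bochner_Integration.integral_add)
        (auto intro!: integrable_mult_right int X1_cont continuous_intros)
    also have "\<dots> \<le> 0" using 1[of p] 2 q by (simp add: mult_nonneg_nonpos add_nonpos_nonpos)
    finally show ?thesis by simp
  qed
  then have "\<forall>X\<in>?W. \<forall>u. test_function u \<and> (\<forall>x. 0 \<le> u x) \<longrightarrow> 0 \<le> - (LINT x:?E|lebesgue. apply_field X u x)"
    by fastforce
  moreover have "V1_half_space ?W"
    unfolding V1_half_space_def by (rule exI[of _ 0], rule exI[of _ 1]) simp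
  moreover have "?E \<in> sets lebesgue" using E by simp
  ultimately show ?thesis unfolding constant_normal_def by blast
qed

section \<open>Product test functions\<close>

text \<open>A one-variable counterpart of \<open>C_k\<close>. The derivative is an existential
  witness rather than \<open>deriv\<close>, so each closure property only has to exhibit the
  derivative given by the calculus rule.\<close>

primrec smooth_upto :: "nat \<Rightarrow> (real \<Rightarrow> real) \<Rightarrow> bool" where
  "smooth_upto 0 f \<longleftrightarrow> continuous_on UNIV f"
| "smooth_upto (Suc k) f \<longleftrightarrow> (\<exists>f'. (\<forall>x. (f has_real_derivative f' x) (at x)) \<and> smooth_upto k f')"

lemma smooth_upto_SucI:
  "(\<And>x. (f has_real_derivative f' x) (at x)) \<Longrightarrow> smooth_upto k f' \<Longrightarrow> smooth_upto (Suc k) f"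
  by (simp only: smooth_upto.simps) blast

lemma smooth_upto_SucD:
  "smooth_upto (Suc k) f \<Longrightarrow> \<exists>f'. (\<forall>x. (f has_real_derivative f' x) (at x)) \<and> smooth_upto k f'"
  by (simp only: smooth_upto.simps)

declare smooth_upto.simps(2) [simp del]

text \<open>The product rule multiplies a derivative by an undifferentiated factor, so order k + 1
  has to yield order k.\<close>

lemma smooth_upto_antimono: "smooth_upto (Suc k) f \<Longrightarrow> smooth_upto k f"
proof (induction k arbitrary: f)
  case 0
  then obtain f' where "\<And>x. (f has_real_derivative f' x) (at x)"
    using smooth_upto_SucD by blast
  then have "continuous_on UNIV f"
    by (rule DERIV_continuous_on)
  then show ?case by simp
next
  case (Suc k)
  obtain f' where f': "\<And>x. (f has_real_derivative f' x) (at x)" "smooth_upto (Suc k) f'"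
    using smooth_upto_SucD[OF Suc.prems] by blast
  show ?case by (rule smooth_upto_SucI[OF f'(1) Suc.IH[OF f'(2)]])
qed

lemma smooth_upto_const: "smooth_upto k (\<lambda>_. c)"
proof (induction k arbitrary: c)
  case (Suc k)
  show ?case by (rule smooth_upto_SucI[OF DERIV_const Suc])
qed simp

lemma smooth_upto_add: "smooth_upto k f \<Longrightarrow> smooth_upto k g \<Longrightarrow> smooth_upto k (\<lambda>x. f x + g x)"
proof (induction k arbitrary: f g)
  case 0
  then show ?case by (auto intro: continuous_on_add)
next
  case (Suc k)
  obtain f' where f': "\<And>x. (f has_real_derivative f' x) (at x)" "smooth_upto k f'"
    using smooth_upto_SucD[OF Suc.prems(1)] by blast
  obtain g' where g': "\<And>x. (g has_real_derivative g' x) (at x)" "smooth_upto k g'"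
    using smooth_upto_SucD[OF Suc.prems(2)] by blast
  show ?case
    by (rule smooth_upto_SucI[OF DERIV_add[OF f'(1) g'(1)] Suc.IH[OF f'(2) g'(2)]])
qed

lemma smooth_upto_mult: "smooth_upto k f \<Longrightarrow> smooth_upto k g \<Longrightarrow> smooth_upto k (\<lambda>x. f x * g x)"
proof (induction k arbitrary: f g)
  case 0
  then show ?case by (auto intro: continuous_on_mult)
next
  case (Suc k)
  obtain f' where f': "\<And>x. (f has_real_derivative f' x) (at x)" "smooth_upto k f'"
    using smooth_upto_SucD[OF Suc.prems(1)] by blast
  obtain g' where g': "\<And>x. (g has_real_derivative g' x) (at x)" "smooth_upto k g'"
    using smooth_upto_SucD[OF Suc.prems(2)] by blast
  have "smooth_upto k (\<lambda>x. f' x * g x + g' x * f x)"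
    using Suc.IH[OF f'(2) smooth_upto_antimono[OF Suc.prems(2)]]
      Suc.IH[OF g'(2) smooth_upto_antimono[OF Suc.prems(1)]] by (rule smooth_upto_add)
  from DERIV_mult[OF f'(1) g'(1)] this show ?case by (rule smooth_upto_SucI)
qed

lemma smooth_upto_affine: "smooth_upto k f \<Longrightarrow> smooth_upto k (\<lambda>x. f (c * x + d))"
proof (induction k arbitrary: f)
  case 0
  then have "continuous_on UNIV f" by simp
  then have "continuous_on UNIV (\<lambda>x. f (c * x + d))"
    by (rule continuous_on_compose2[of UNIV f _ "\<lambda>x. c * x + d"]) (auto intro!: continuous_intros)
  then show ?case by simp
next
  case (Suc k)
  obtain f' where f': "\<And>x. (f has_real_derivative f' x) (at x)" "smooth_upto k f'"
    using smooth_upto_SucD[OF Suc.prems] by blast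
  have "((\<lambda>x. c * x + d) has_real_derivative c) (at x)" for x
    by (auto intro!: derivative_eq_intros)
  from DERIV_chain2[OF f'(1) this] show ?case
    by (rule smooth_upto_SucI) (rule smooth_upto_mult[OF Suc.IH[OF f'(2)] smooth_upto_const])
qed

lemma smooth_upto_sum:
  "(\<And>i. i \<in> I \<Longrightarrow> smooth_upto k (f i)) \<Longrightarrow> smooth_upto k (\<lambda>x. \<Sum>i\<in>I. f i x)"
proof (induction I rule: infinite_finite_induct)
  case (insert i I)
  then show ?case by (simp add: smooth_upto_add)
qed (simp_all add: smooth_upto_const)

text \<open>The classical flat function exp(-1/t), with a polynomial in 1/t as extra factor. The
  polynomial parameter makes the family closed under differentiation, so smoothness becomes one
  induction.\<close>

definition flat_exp :: "real poly \<Rightarrow> real \<Rightarrow> real" where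
  "flat_exp p t = (if t \<le> 0 then 0 else poly p (1 / t) * exp (- (1 / t)))"

lemma poly_times_exp_tendsto_0: "((\<lambda>s. poly p s * exp (- s)) \<longlongrightarrow> (0::real)) at_top"
proof -
  have "((\<lambda>s. \<Sum>i\<le>degree p. coeff p i * (s ^ i / exp s)) \<longlongrightarrow> (\<Sum>i\<le>degree p. coeff p i * 0)) at_top"
    by (intro tendsto_sum tendsto_mult tendsto_const tendsto_power_div_exp_0)
  then show ?thesis
    by (simp add: poly_altdef sum_distrib_right exp_minus divide_inverse mult.assoc)
qed

lemma flat_exp_tendsto_0: "(flat_exp p \<longlongrightarrow> 0) (at 0)"
proof -
  have "(flat_exp p \<longlongrightarrow> 0) (at_left 0)"
    by (rule tendsto_eventually) (auto simp: flat_exp_def eventually_at_filter)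
  moreover have "((\<lambda>t. poly p (inverse t) * exp (- inverse t)) \<longlongrightarrow> 0) (at_right 0)"
    by (rule filterlim_compose[OF poly_times_exp_tendsto_0 filterlim_inverse_at_top_right])
  then have "(flat_exp p \<longlongrightarrow> 0) (at_right 0)"
    by (rule Lim_transform_eventually)
      (auto simp: flat_exp_def eventually_at_filter divide_inverse)
  ultimately show ?thesis
    using filterlim_at_split by blast
qed

text \<open>For t > 0 put s = 1/t: since ds/dt = - s^2, the derivative of p(s) exp(-s) is s^2 (p -
  p')(s) exp(-s), and \<open>[:0, 0, 1:]\<close> stands for s^2.\<close>

lemma has_real_derivative_flat_exp:
  "(flat_exp p has_real_derivative flat_exp ([:0, 0, 1:] * (p - pderiv p)) t) (at t)"
proof -
  consider "t < 0" | "t = 0" | "t > 0" by linarith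
  then show ?thesis
  proof cases
    case 1
    have "((\<lambda>_. 0) has_real_derivative 0) (at t)" by simp
    then have "(flat_exp p has_real_derivative 0) (at t)"
      by (rule has_field_derivative_transform_within_open[where S = "{..<0}"])
        (use 1 in \<open>auto simp: flat_exp_def\<close>)
    then show ?thesis using 1 by (simp add: flat_exp_def)
  next
    case 2
    \<comment> \<open>Division by h multiplies the polynomial by 1/h, so the difference quotient at
      0 is again a \<open>flat_exp\<close>, with polynomial \<open>[:0, 1:] * p\<close>.\<close>
    have "((\<lambda>h. (flat_exp p (0 + h) - flat_exp p 0) / h) \<longlongrightarrow> 0) (at 0)"
      by (rule Lim_transform_eventually[OF flat_exp_tendsto_0[of "[:0, 1:] * p"]])
        (auto simp: flat_exp_def eventually_at_filter)
    then show ?thesis using 2 by (simp add: flat_exp_def DERIV_def)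
  next
    case 3
    have "((\<lambda>t. poly p (1 / t) * exp (- (1 / t))) has_real_derivative
        flat_exp ([:0, 0, 1:] * (p - pderiv p)) t) (at t)"
    proof -
      have inv: "((\<lambda>t. 1 / t) has_real_derivative - (1 / t) * (1 / t)) (at t)"
        using 3 by (auto intro!: derivative_eq_intros)
      show ?thesis
        by (rule DERIV_cong[OF DERIV_mult[OF DERIV_chain2[OF poly_DERIV inv]
                DERIV_chain2[OF DERIV_exp DERIV_minus[OF inv]]]])
          (use 3 in \<open>simp add: flat_exp_def field_split_simps\<close>)
    qed
    then show ?thesis
      by (rule has_field_derivative_transform_within_open[where S = "{0<..}"])
        (use 3 in \<open>auto simp: flat_exp_def\<close>)
  qed
qed

lemma smooth_upto_flat_exp: "smooth_upto k (flat_exp p)"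
proof (induction k arbitrary: p)
  case 0
  have "continuous_on UNIV (flat_exp p)"
    by (rule DERIV_continuous_on[OF has_real_derivative_flat_exp])
  then show ?case by simp
next
  case (Suc k)
  show ?case by (rule smooth_upto_SucI[OF has_real_derivative_flat_exp Suc])
qed

text \<open>Writing the partial derivative over the updated family \<open>g(j := g' j)\<close> gives
  it the same shape as the function itself, which carries the induction in
  \<open>C_k_prod\<close>.\<close>

lemma partial_deriv_prod:
  fixes g g' :: "5 \<Rightarrow> real \<Rightarrow> real"
  assumes d: "\<And>i t. (g i has_real_derivative g' i t) (at t)"
  shows "(\<lambda>x. \<Prod>i\<in>UNIV. g i (x$i)) differentiable (at x)"
    and "partial_deriv j (\<lambda>x. \<Prod>i\<in>UNIV. g i (x$i)) x = (\<Prod>i\<in>UNIV. (g(j := g' j)) i (x$i))"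
proof -
  let ?D = "\<lambda>y. \<Sum>i\<in>UNIV. (g' i (x$i) * y$i) * (\<Prod>k\<in>UNIV - {i}. g k (x$k))"
  have "((\<lambda>x. g i (x$i)) has_derivative (\<lambda>y. g' i (x$i) * y$i)) (at x)" for i
  proof -
    have "((\<lambda>x. x$i) has_derivative (\<lambda>y. y$i)) (at x)"
      by (rule bounded_linear_imp_has_derivative[OF bounded_linear_vec_nth])
    from has_derivative_compose[OF this d[unfolded has_field_derivative_def]] show ?thesis .
  qed
  then have D: "((\<lambda>x. \<Prod>i\<in>UNIV. g i (x$i)) has_derivative ?D) (at x)"
    by (intro has_derivative_prod)
  then show "(\<lambda>x. \<Prod>i\<in>UNIV. g i (x$i)) differentiable (at x)"
    by (auto simp: differentiable_def)
  have "partial_deriv j (\<lambda>x. \<Prod>i\<in>UNIV. g i (x$i)) x = ?D (axis j 1)"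
    by (simp only: partial_deriv_def frechet_derivative_at[OF D, symmetric])
  also have "\<dots> = (\<Sum>i\<in>UNIV. if i = j then g' j (x$j) * (\<Prod>k\<in>UNIV - {j}. g k (x$k)) else 0)"
    by (intro sum.cong) (auto simp: axis_def)
  also have "\<dots> = g' j (x$j) * (\<Prod>k\<in>UNIV - {j}. g k (x$k))" by simp
  also have "(\<Prod>k\<in>UNIV - {j}. g k (x$k)) = (\<Prod>k\<in>UNIV - {j}. (g(j := g' j)) k (x$k))"
    by (intro prod.cong) auto
  also have "g' j (x$j) * \<dots> = (\<Prod>i\<in>UNIV. (g(j := g' j)) i (x$i))"
    by (subst (2) prod.remove[of _ j]) auto
  finally show "partial_deriv j (\<lambda>x. \<Prod>i\<in>UNIV. g i (x$i)) x = (\<Prod>i\<in>UNIV. (g(j := g' j)) i (x$i))" .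
qed

lemma C_k_prod:
  fixes g :: "5 \<Rightarrow> real \<Rightarrow> real"
  assumes "\<And>i. smooth_upto k (g i)"
  shows "C_k k (\<lambda>x. \<Prod>i\<in>UNIV. g i (x$i))"
  using assms
proof (induction k arbitrary: g)
  case 0
  have "continuous_on UNIV (\<lambda>x::real^5. g i (x$i))" for i
    using 0[of i] by (intro continuous_on_compose2[of UNIV "g i" UNIV "\<lambda>x. x$i"]) (auto intro!: continuous_intros)
  then show ?case by (simp add: continuous_on_prod)
next
  case (Suc k)
  have "\<forall>i. \<exists>f'. (\<forall>x. (g i has_real_derivative f' x) (at x)) \<and> smooth_upto k f'"
    using smooth_upto_SucD[OF Suc.prems] by blast
  from choice[OF this] obtain g' where g': "\<And>i t. (g i has_real_derivative g' i t) (at t)" "\<And>i. smooth_upto k (g' i)"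
    by blast
  have "C_k k (\<lambda>x. \<Prod>i\<in>UNIV. (g(j := g' j)) i (x$i))" for j
    by (rule Suc.IH) (simp add: g'(2) smooth_upto_antimono[OF Suc.prems])
  then have "C_k k (partial_deriv j (\<lambda>x. \<Prod>i\<in>UNIV. g i (x$i)))" for j
    by (simp only: partial_deriv_prod(2)[OF g'(1), abs_def])
  moreover have "(\<lambda>x. \<Prod>i\<in>UNIV. g i (x$i)) differentiable_on UNIV"
    using partial_deriv_prod(1)[OF g'(1)] by (simp add: differentiable_on_def)
  ultimately show ?case by simp
qed

lemma test_function_prod:
  fixes g :: "5 \<Rightarrow> real \<Rightarrow> real"
  assumes "\<And>i k. smooth_upto k (g i)" "\<And>i t. t \<notin> {0..1} \<Longrightarrow> g i t = 0"
  shows "test_function (\<lambda>x. \<Prod>i\<in>UNIV. g i (x$i))"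
    and "x \<notin> cbox 0 1 \<Longrightarrow> (\<Prod>i\<in>UNIV. g i (x$i)) = 0"
proof -
  show outside: "(\<Prod>i\<in>UNIV. g i (x$i)) = 0" if "x \<notin> cbox 0 1" for x
  proof -
    obtain i where "x$i \<notin> {0..1}" using \<open>x \<notin> cbox 0 1\<close> by (auto simp: mem_box_cart)
    then show ?thesis using assms(2)[of "x$i" i] by (intro prod_zero) auto
  qed
  have "closure {x::real^5. (\<Prod>i\<in>UNIV. g i (x$i)) \<noteq> 0} \<subseteq> cbox 0 1"
    using outside by (intro closure_minimal) auto
  then have "compact (closure {x::real^5. (\<Prod>i\<in>UNIV. g i (x$i)) \<noteq> 0})"
    by (meson bounded_cbox bounded_subset closed_closure compact_eq_bounded_closed)
  then show "test_function (\<lambda>x. \<Prod>i\<in>UNIV. g i (x$i))"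
    using C_k_prod assms(1) by (simp add: test_function_def)
qed

section \<open>A smooth bump on the unit interval\<close>

definition bump :: "real \<Rightarrow> real" where
  "bump t = flat_exp 1 t * flat_exp 1 (1 - t)"

lemma flat_exp_1: "flat_exp 1 t = (if t \<le> 0 then 0 else exp (- (1 / t)))"
  by (simp add: flat_exp_def)

lemma smooth_upto_bump: "smooth_upto k bump"
proof -
  have "smooth_upto k (\<lambda>t. flat_exp 1 t * flat_exp 1 ((- 1) * t + 1))"
    by (rule smooth_upto_mult[OF smooth_upto_flat_exp smooth_upto_affine[OF smooth_upto_flat_exp]])
  then show ?thesis by (simp add: bump_def[abs_def])
qed

lemma bump_bounds: "0 \<le> bump t" "bump t \<le> 1"
  by (auto simp: bump_def flat_exp_1 mult_le_one)

lemma bump_eq_0: "t \<notin> {0<..<1} \<Longrightarrow> bump t = 0"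
  by (auto simp: bump_def flat_exp_1)

text \<open>Both t and 1 - t are at least 1/16, so each \<open>flat_exp\<close> factor is at least
  exp(-16). The interval is chosen to contain every bump argument that occurs on the box where the
  variation is bounded below.\<close>

lemma bump_lower_bound:
  assumes "1 / 16 \<le> t" "t \<le> 3 / 4"
  shows "exp (- 32) \<le> bump t"
proof -
  have *: "exp (- 16) \<le> flat_exp 1 s" if "1 / 16 \<le> s" for s
    using that by (simp add: flat_exp_1 field_simps)
  have "exp (- 32) = exp (- 16) * exp (- 16 :: real)" by (simp flip: exp_add)
  also have "\<dots> \<le> flat_exp 1 t * flat_exp 1 (1 - t)"
    using assms by (intro mult_mono *) (auto simp: flat_exp_1)
  finally show ?thesis by (simp add: bump_def)
qed

lemma bump_derivative:
  obtains b' where "\<And>t. (bump has_real_derivative b' t) (at t)" "continuous_on UNIV b'"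
    "\<And>t. t \<notin> {0..1} \<Longrightarrow> b' t = 0"
proof -
  obtain b' where b': "\<And>t. (bump has_real_derivative b' t) (at t)" "smooth_upto 0 b'"
    using smooth_upto_SucD[OF smooth_upto_bump[of "Suc 0"]] by blast
  have "b' t = 0" if "t \<notin> {0..1}" for t
  proof -
    have "((\<lambda>_. 0) has_real_derivative 0) (at t)" by simp
    then have "(bump has_real_derivative 0) (at t)"
      by (rule has_field_derivative_transform_within_open[where S = "- {0..1}"])
        (use that bump_eq_0 in auto)
    then show ?thesis using b'(1) DERIV_unique by blast
  qed
  from that[OF b'(1) _ this] b'(2) show thesis by simp
qed

text \<open>
  Near the gap \<open>(p, p + \<epsilon>)\<close> the \<open>r\<close>-neighbourhood of \<open>K\<close> meets the support \<open>[p, p + \<epsilon>/2]\<close> of the bump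
  in \<open>[p, p + r]\<close>, so each gap contributes the increment of the bump over that interval.
\<close>

lemma neighbourhood_slice_integral:
  fixes K P :: "real set"
  assumes "0 < \<epsilon>" "finite P"
    and K: "\<And>p. p \<in> P \<Longrightarrow> p \<in> K" "\<And>p x. p \<in> P \<Longrightarrow> x \<in> K \<Longrightarrow> x \<le> p \<or> p + \<epsilon> \<le> x"
    and r: "0 \<le> r" "r < \<epsilon> / 2"
    and b': "\<And>t. (bump has_real_derivative b' t) (at t)" "continuous_on UNIV b'"
    "\<And>t. t \<notin> {0..1} \<Longrightarrow> b' t = 0"
  shows "(LINT y|lborel. indicator {y. \<exists>t\<in>K. (y - t)\<^sup>2 \<le> r\<^sup>2} y * (\<Sum>p\<in>P. 2 / \<epsilon> * b' (2 * (y - p) / \<epsilon>)))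
    = card P * bump (2 * r / \<epsilon>)"
proof -
  let ?N = "{y. \<exists>t\<in>K. (y - t)\<^sup>2 \<le> r\<^sup>2}"
  let ?f = "\<lambda>p y. 2 / \<epsilon> * b' (2 * (y - p) / \<epsilon>)"
  have one: "has_bochner_integral lborel (\<lambda>y. indicator ?N y * ?f p y) (bump (2 * r / \<epsilon>))" if p: "p \<in> P" for p
  proof -
    have "((\<lambda>y. bump (2 * (y - p) / \<epsilon>)) has_real_derivative ?f p y) (at y)" for y
    proof -
      have "((\<lambda>y. 2 * (y - p) / \<epsilon>) has_real_derivative 2 / \<epsilon>) (at y)"
        using \<open>0 < \<epsilon>\<close> by (auto intro!: derivative_eq_intros)
      from DERIV_chain2[OF b'(1) this] show ?thesis by (simp add: mult.commute)
    qed
    moreover have "isCont (?f p) y" for y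
    proof -
      have "continuous_on UNIV (\<lambda>y. b' (2 * (y - p) / \<epsilon>))"
        using b'(2) \<open>0 < \<epsilon>\<close>
        by (intro continuous_on_compose2[of UNIV b' UNIV "\<lambda>y. 2 * (y - p) / \<epsilon>"]) (auto intro!: continuous_intros)
      then have "continuous_on UNIV (?f p)" by (intro continuous_intros)
      then show ?thesis by (simp add: continuous_on_eq_continuous_at)
    qed
    ultimately have integ: "has_bochner_integral lborel (\<lambda>y. ?f p y * indicator {p..p + r} y)
        (bump (2 * (p + r - p) / \<epsilon>) - bump (2 * (p - p) / \<epsilon>))"
      using r(1) by (intro has_bochner_integral_FTC_Icc_real[where F = "\<lambda>y. bump (2 * (y - p) / \<epsilon>)"]) auto
    \<comment> \<open>Off the half-gap from p to p + eps/2 the factor \<open>b'\<close> vanishes.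
      For y in it, a point of \<open>K\<close> within r < eps/2 of y cannot lie beyond the gap, so
      it is at most p and y <= p + r; conversely p itself is a point of \<open>K\<close>.\<close>
    have swap: "?f p y * indicator {p..p + r} y = indicator ?N y * ?f p y" for y
    proof (cases "y \<in> {p..p + \<epsilon> / 2}")
      case True
      have "y \<in> ?N \<longleftrightarrow> y \<le> p + r"
      proof
        assume "y \<in> ?N"
        then obtain t where t: "t \<in> K" "(y - t)\<^sup>2 \<le> r\<^sup>2" by auto
        then have "\<bar>y - t\<bar> \<le> r" using abs_le_square_iff[of "y - t" r] r(1) by simp
        then show "y \<le> p + r" using K(2)[OF p t(1)] True r by auto
      next
        assume "y \<le> p + r"
        then have "(y - p)\<^sup>2 \<le> r\<^sup>2" using True by (intro power_mono) auto
        then show "y \<in> ?N" using K(1)[OF p] by auto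
      qed
      then show ?thesis using True by (auto simp: indicator_def)
    next
      case False
      then have "2 * (y - p) / \<epsilon> \<notin> {0..1}" using \<open>0 < \<epsilon>\<close> by (auto simp: field_simps)
      then show ?thesis using b'(3) by simp
    qed
    have "bump (2 * (p + r - p) / \<epsilon>) - bump (2 * (p - p) / \<epsilon>) = bump (2 * r / \<epsilon>)"
      using bump_eq_0[of 0] by simp
    with integ show ?thesis unfolding swap by (simp only:)
  qed
  have "has_bochner_integral lborel (\<lambda>y. \<Sum>p\<in>P. indicator ?N y * ?f p y) (\<Sum>p\<in>P. bump (2 * r / \<epsilon>))"
    using one by (intro has_bochner_integral_sum)
  then show ?thesis
    by (simp add: sum_distrib_left has_bochner_integral_integral_eq)
qed

section \<open>Gaps of the Cantor set\<close>

lemma remove_middle_eq: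
  "remove_middle l s = [(fst s, (fst s + snd s) / 2 - l / 2), ((fst s + snd s) / 2 + l / 2, snd s)]"
  by (cases s) simp

lemma length_concat_remove_middle: "length (concat (map (remove_middle l) xs)) = 2 * length xs"
  by (induction xs) (simp_all add: remove_middle_eq)

text \<open>The order survives because the two pieces stay inside their segment and are separated by
  \<open>l\<close> > 0.\<close>

lemma sorted_concat_remove_middle:
  assumes "sorted_wrt (\<lambda>s t. snd s < fst t) xs" "\<forall>s\<in>set xs. l < snd s - fst s" "0 < l"
  shows "sorted_wrt (\<lambda>s t. snd s < fst t) (concat (map (remove_middle l) xs))"
  using assms
proof (induction xs)
  case (Cons s xs)
  have "snd u < fst t" if "u \<in> set (remove_middle l s)" "s' \<in> set xs" "t \<in> set (remove_middle l s')" for u s' t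
  proof -
    have "snd s < fst s'" "l < snd s - fst s" "l < snd s' - fst s'"
      using Cons.prems that by auto
    then show ?thesis using that \<open>0 < l\<close> by (auto simp: remove_middle_eq field_simps)
  qed
  then show ?case
    using Cons by (auto simp: sorted_wrt_append) (auto simp: remove_middle_eq)
qed simp

text \<open>Common length of the 2^(n+1) segments of step n: what remains of [0,1], shared
  equally.\<close>

definition cantor_length :: "(nat \<Rightarrow> real) \<Rightarrow> nat \<Rightarrow> real" where
  "cantor_length a n = (1 - (\<Sum>j\<le>n. a j)) / 2 ^ Suc n"

definition cantor_gap :: "(nat \<Rightarrow> real) \<Rightarrow> nat \<Rightarrow> real" where
  "cantor_gap a n = a n / 2 ^ n"

locale fat_cantor =
  fixes a :: "nat \<Rightarrow> real"
  assumes pos: "\<And>j. 0 < a j" and summable: "summable a" and sum_less_1: "(\<Sum>j. a j) < 1"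
begin

lemma partial_sum_less_1: "(\<Sum>j\<le>n. a j) < 1"
  using sum_le_suminf[OF summable, of "{..n}"] pos sum_less_1 by (auto intro: less_imp_le le_less_trans)

lemma cantor_length_pos: "0 < cantor_length a n"
  using partial_sum_less_1[of n] by (simp add: cantor_length_def)

lemma cantor_length_Suc: "2 * cantor_length a (Suc n) = cantor_length a n - cantor_gap a (Suc n)"
  by (simp add: cantor_length_def cantor_gap_def field_simps)

lemma cantor_gap_pos: "0 < cantor_gap a n"
  using pos by (simp add: cantor_gap_def)

lemma cantor_gap_less_1: "cantor_gap a n < 1"
proof -
  have "a n \<le> (\<Sum>j\<le>n. a j)"
    using pos by (intro member_le_sum) (auto intro: less_imp_le)
  also have "\<dots> < 1" by (rule partial_sum_less_1)
  also have "1 \<le> (2::real) ^ n" by simp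
  finally show ?thesis by (simp add: cantor_gap_def)
qed

lemma set_cantor_segments_Suc:
  "set (cantor_segments a (Suc n)) = (\<Union>s\<in>set (cantor_segments a n). set (remove_middle (cantor_gap a (Suc n)) s))"
  by (simp add: cantor_gap_def)

lemma cantor_segment_length: "s \<in> set (cantor_segments a n) \<Longrightarrow> snd s - fst s = cantor_length a n"
proof (induction n arbitrary: s)
  case 0
  then show ?case by (auto simp: cantor_length_def field_simps)
next
  case (Suc n)
  then obtain s' where s': "s' \<in> set (cantor_segments a n)" "s \<in> set (remove_middle (cantor_gap a (Suc n)) s')"
    by (auto simp only: set_cantor_segments_Suc)
  from s'(2) have "2 * (snd s - fst s) = snd s' - fst s' - cantor_gap a (Suc n)"
    by (auto simp: remove_middle_eq field_simps)
  then show ?case using Suc.IH[OF s'(1)] cantor_length_Suc[of n] by simp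
qed

lemma cantor_segment_less: "s \<in> set (cantor_segments a n) \<Longrightarrow> fst s < snd s"
  using cantor_segment_length cantor_length_pos by (metis diff_gt_0_iff_gt)

text \<open>The excess over the next gap is twice the next segment length, which is positive because
  the a_j sum to less than 1.\<close>

lemma cantor_gap_less_length: "s \<in> set (cantor_segments a n) \<Longrightarrow> cantor_gap a (Suc n) < snd s - fst s"
  using cantor_segment_length[of s n] cantor_length_Suc[of n] cantor_length_pos[of "Suc n"] by simp

text \<open>The ordering yields disjointness of the segments and later lets the gaps be counted
  without repetition.\<close>

lemma sorted_cantor_segments: "sorted_wrt (\<lambda>s t. snd s < fst t) (cantor_segments a n)"
proof (induction n)
  case 0
  show ?case using pos[of 0] by simp
next
  case (Suc n)
  have "sorted_wrt (\<lambda>s t. snd s < fst t)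
      (concat (map (remove_middle (cantor_gap a (Suc n))) (cantor_segments a n)))"
    using Suc cantor_gap_less_length cantor_gap_pos by (intro sorted_concat_remove_middle) auto
  then show ?case by (simp add: cantor_gap_def)
qed

text \<open>The exponent is n + 1 since step 0 already splits [0,1] in two.\<close>

lemma length_cantor_segments: "length (cantor_segments a n) = 2 ^ Suc n"
  by (induction n) (simp_all add: length_concat_remove_middle)

lemma cantor_segments_disjoint:
  assumes "s \<in> set (cantor_segments a n)" "t \<in> set (cantor_segments a n)" "s \<noteq> t"
  shows "snd s < fst t \<or> snd t < fst s"
  using assms sorted_cantor_segments[of n]
  unfolding in_set_conv_nth sorted_wrt_iff_nth_less by (metis nat_neq_iff)

definition cantor_level :: "nat \<Rightarrow> real set" where
  "cantor_level n = (\<Union>s\<in>set (cantor_segments a n). {fst s..snd s})"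

lemma cantor_set_eq: "cantor_set a = (\<Inter>n. cantor_level n)"
  by (auto simp: cantor_set_def cantor_level_def case_prod_unfold)

lemma cantor_level_Suc_subset: "cantor_level (Suc n) \<subseteq> cantor_level n"
proof
  fix x assume "x \<in> cantor_level (Suc n)"
  then obtain s t where s: "s \<in> set (cantor_segments a n)" "t \<in> set (remove_middle (cantor_gap a (Suc n)) s)"
      "x \<in> {fst t..snd t}"
    unfolding cantor_level_def set_cantor_segments_Suc by blast
  then have "x \<in> {fst s..snd s}"
    using cantor_gap_less_length[OF s(1)] cantor_gap_pos[of "Suc n"] by (auto simp: remove_middle_eq field_simps)
  then show "x \<in> cantor_level n" using s by (auto simp: cantor_level_def)
qed

lemma cantor_level_antimono: "m \<le> n \<Longrightarrow> cantor_level n \<subseteq> cantor_level m"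
  using cantor_level_Suc_subset by (rule lift_Suc_antimono_le)

lemma cantor_set_subset: "cantor_set a \<subseteq> {0..1}"
proof -
  have "cantor_set a \<subseteq> cantor_level 0" by (auto simp: cantor_set_eq)
  also have "\<dots> \<subseteq> {0..1}" using pos[of 0] partial_sum_less_1[of 0] by (auto simp: cantor_level_def)
  finally show ?thesis .
qed

lemma compact_cantor_set: "compact (cantor_set a)"
proof -
  have "closed (cantor_set a)"
    by (auto simp: cantor_set_eq cantor_level_def)
  then show ?thesis
    using cantor_set_subset by (metis compact_Icc compact_Int_closed inf.absorb_iff2)
qed

text \<open>Removing a middle part keeps the outer end points, so an end point of step n recurs at
  every later step; earlier levels contain it because the levels decrease.\<close>

lemma cantor_segment_endpoints:
  assumes "s \<in> set (cantor_segments a n)"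
  shows "fst s \<in> cantor_set a" "snd s \<in> cantor_set a"
proof -
  have *: "\<exists>t\<in>set (cantor_segments a (n + k)). fst t = fst s" "\<exists>t\<in>set (cantor_segments a (n + k)). snd t = snd s" for k
  proof (induction k)
    case (Suc k)
    have "\<exists>u\<in>set (remove_middle l t). fst u = fst t" "\<exists>u\<in>set (remove_middle l t). snd u = snd t" for l t
      by (simp_all add: remove_middle_eq)
    note ends = this
    { case 1
      obtain t where "t \<in> set (cantor_segments a (n + k))" "fst t = fst s" using Suc(1) by blast
      then show ?case
        using ends(1)[of "cantor_gap a (Suc (n + k))" t] unfolding add_Suc_right set_cantor_segments_Suc by auto }
    { case 2
      obtain t where "t \<in> set (cantor_segments a (n + k))" "snd t = snd s" using Suc(2) by blast
      then show ?case
        using ends(2)[of "cantor_gap a (Suc (n + k))" t] unfolding add_Suc_right set_cantor_segments_Suc by auto }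
  qed (use assms in auto)
  have "fst s \<in> cantor_level (n + k) \<and> snd s \<in> cantor_level (n + k)" for k
  proof -
    obtain t u where tu: "t \<in> set (cantor_segments a (n + k))" "fst t = fst s"
        "u \<in> set (cantor_segments a (n + k))" "snd u = snd s"
      using *[of k] by blast
    have "fst s \<in> {fst t..snd t}" "snd s \<in> {fst u..snd u}"
      using tu cantor_segment_less[OF tu(1)] cantor_segment_less[OF tu(3)] by simp_all
    then show ?thesis using tu(1,3) unfolding cantor_level_def by blast
  qed
  then have "fst s \<in> cantor_level k \<and> snd s \<in> cantor_level k" for k
    using cantor_level_antimono[of k "n + k"] by auto
  then show "fst s \<in> cantor_set a" "snd s \<in> cantor_set a" by (auto simp: cantor_set_eq)
qed

text \<open>The gaps of step m + 1 are the middles of the 2^(m+1) segments of step m, and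
  \<open>P\<close> collects their left ends. Both ends of a gap are end points of segments of step m
  + 1, hence survive in the Cantor set.\<close>

lemma cantor_gaps:
  obtains P where "finite P" "card P = 2 ^ Suc m"
    "\<And>p. p \<in> P \<Longrightarrow> p \<in> cantor_set a" "\<And>p. p \<in> P \<Longrightarrow> p + cantor_gap a (Suc m) \<in> cantor_set a"
    "\<And>p x. p \<in> P \<Longrightarrow> x \<in> cantor_set a \<Longrightarrow> x \<le> p \<or> p + cantor_gap a (Suc m) \<le> x"
proof
  let ?S = "cantor_segments a m" and ?l = "cantor_gap a (Suc m)"
  let ?f = "\<lambda>s. (fst s + snd s) / 2 - ?l / 2"
  let ?P = "set (map ?f ?S)"
  show "finite ?P" by simp
  \<comment> \<open>Strict increase along the ordered list: distinct segments give distinct gaps, so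
    \<open>?P\<close> has full cardinality.\<close>
  have "?f s < ?f t" if "s \<in> set ?S" "t \<in> set ?S" "snd s < fst t" for s t
    using cantor_segment_less[OF that(1)] cantor_segment_less[OF that(2)] that(3) by simp
  then have "sorted_wrt (<) (map ?f ?S)"
    unfolding sorted_wrt_map by (rule sorted_wrt_mono_rel[OF _ sorted_cantor_segments])
  then have "distinct (map ?f ?S)" by (simp add: strict_sorted_iff)
  then show "card ?P = 2 ^ Suc m"
    by (subst distinct_card) (simp_all only: length_map length_cantor_segments)
  fix p assume "p \<in> ?P"
  then obtain s where s: "s \<in> set ?S" and p: "p = ?f s" by auto
  have sub: "set (remove_middle ?l s) \<subseteq> set (cantor_segments a (Suc m))"
    using s by (auto simp only: set_cantor_segments_Suc)
  have ends: "(fst s, p) \<in> set (cantor_segments a (Suc m))" "(p + ?l, snd s) \<in> set (cantor_segments a (Suc m))"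
    by (rule subsetD[OF sub], simp add: remove_middle_eq p field_simps)+
  show "p \<in> cantor_set a" using cantor_segment_endpoints(2)[OF ends(1)] by simp
  show "p + ?l \<in> cantor_set a" using cantor_segment_endpoints(1)[OF ends(2)] by simp
  show "x \<le> p \<or> p + ?l \<le> x" if "x \<in> cantor_set a" for x
  proof -
    from that have "x \<in> cantor_level (Suc m)" by (auto simp: cantor_set_eq)
    then obtain s' t where s': "s' \<in> set ?S" "t \<in> set (remove_middle ?l s')" "x \<in> {fst t..snd t}"
      unfolding cantor_level_def set_cantor_segments_Suc by blast
    note lt = cantor_gap_less_length[OF s] cantor_gap_less_length[OF s'(1)] cantor_gap_pos[of "Suc m"]
    show ?thesis
    proof (cases "s' = s")
      case True
      then show ?thesis using s' p by (auto simp: remove_middle_eq field_simps)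
    next
      case False
      then show ?thesis using cantor_segments_disjoint[OF s'(1) s] s' p lt
        by (auto simp: remove_middle_eq field_simps)
    qed
  qed
qed

end

section \<open>Unbounded variation near the gaps\<close>

text \<open>
  With \<open>x\<^sub>2 = \<delta> w/2\<close> and \<open>\<delta>\<^sup>3 = \<epsilon>\<^sup>2\<close> the slice of the set over \<open>(x\<^sub>1,\<dots>,x\<^sub>4)\<close> is the \<open>r\<close>-neighbourhood
  of \<open>K\<close> with \<open>2 r/\<epsilon> = sqrt (w\<^sup>3 x\<^sub>4)\<close>, so the contribution of a gap does not depend on \<open>\<epsilon>\<close>.
\<close>

lemma gap_test_function:
  fixes K P :: "real set" and \<epsilon> \<delta> :: real
  assumes K: "compact K"
    and \<epsilon>: "0 < \<epsilon>" "\<epsilon> < 1" and \<delta>: "0 < \<delta>" "\<delta> ^ 3 = \<epsilon>\<^sup>2"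
    and P: "finite P" "\<And>p. p \<in> P \<Longrightarrow> p \<in> K" "\<And>p. p \<in> P \<Longrightarrow> p + \<epsilon> \<in> K"
      "\<And>p x. p \<in> P \<Longrightarrow> x \<in> K \<Longrightarrow> x \<le> p \<or> p + \<epsilon> \<le> x"
    and K01: "K \<subseteq> {0..1}"
  obtains u where "test_function u" "\<And>x. norm (u x) \<le> indicator (cbox 0 1) x"
    "exp (- 32) ^ 5 / 64 * (card P * \<delta>) \<le> (LINT x:cone_union K|lebesgue. partial_deriv 5 u x)"
proof -
  obtain b' where b': "\<And>t. (bump has_real_derivative b' t) (at t)" "continuous_on UNIV b'"
    "\<And>t. t \<notin> {0..1} \<Longrightarrow> b' t = 0"
    by (rule bump_derivative) (rule that)
  let ?E = "cone_union K"
  let ?c = "exp (- 32) :: real"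
  \<comment> \<open>Each bump sits on the left half of its gap. For r < eps/2 it sees the jump at p
    + r but not the opposite one at p + eps - r, so nothing cancels.\<close>
  define G where "G t = (\<Sum>p\<in>P. bump (2 * (t - p) / \<epsilon>))" for t
  define G' where "G' t = (\<Sum>p\<in>P. 2 / \<epsilon> * b' (2 * (t - p) / \<epsilon>))" for t
  \<comment> \<open>The x_2 factor lives on 0 < x_2 < delta/2, where the radius is below eps/2 as
    long as 0 < x_4 < 1.\<close>
  define g where "g i = (if i = 5 then G else if i = 2 then (\<lambda>t. bump (2 * t / \<delta>)) else bump)" for i :: 5
  define u where "u = (\<lambda>x::real^5. \<Prod>i\<in>UNIV. g i (x$i))"
  have scaled: "smooth_upto k (\<lambda>t. bump (2 * (t - p) / \<epsilon>))" for k p \<epsilon>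
    using smooth_upto_affine[OF smooth_upto_bump, of k "2 / \<epsilon>" "- (2 * p / \<epsilon>)"]
    by (simp add: algebra_simps diff_divide_distrib)
  have smooth_G: "smooth_upto k G" for k
    unfolding G_def by (intro smooth_upto_sum scaled)
  have smooth_g: "smooth_upto k (g i)" for k i
    using smooth_G smooth_upto_bump scaled[of k 0 \<delta>] by (simp add: g_def)
  have \<delta>1: "\<delta> < 1"
  proof (rule ccontr)
    assume "\<not> \<delta> < 1"
    then have "1 \<le> \<delta> ^ 3" by simp
    moreover have "\<epsilon>\<^sup>2 < 1" using \<epsilon> by (simp add: power_less_one_iff)
    ultimately show False using \<delta>(2) by simp
  qed
  \<comment> \<open>Each left end lies in \<open>K\<close>, hence outside the other gaps; so
    distinct left ends are at least eps apart and at most one bump is nonzero at t. This keeps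
    \<open>u\<close> bounded by 1 however many gaps there are.\<close>
  have G_bounds: "0 \<le> G t \<and> G t \<le> 1 \<and> (t \<notin> {0..1} \<longrightarrow> G t = 0)" for t
  proof (cases "\<exists>p\<in>P. t \<in> {p<..<p + \<epsilon> / 2}")
    case True
    then obtain p where p: "p \<in> P" "t \<in> {p<..<p + \<epsilon> / 2}" by auto
    have "bump (2 * (t - q) / \<epsilon>) = 0" if "q \<in> P - {p}" for q
    proof -
      have "p + \<epsilon> \<le> q \<or> q + \<epsilon> \<le> p"
        using P(4)[of p q] P(4)[of q p] P(2) p that by fastforce
      then show ?thesis using p(2) \<epsilon>(1) by (intro bump_eq_0) (auto simp: field_simps)
    qed
    then have "G t = bump (2 * (t - p) / \<epsilon>)"
      unfolding G_def using p(1) P(1) by (subst sum.remove[of _ p]) auto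
    moreover have "t \<in> {0..1}" using p P(2,3)[OF p(1)] K01 \<epsilon> by fastforce
    ultimately show ?thesis using bump_bounds by simp
  next
    case False
    then have "bump (2 * (t - p) / \<epsilon>) = 0" if "p \<in> P" for p
      using that \<epsilon>(1) by (intro bump_eq_0) (auto simp: field_simps)
    then show ?thesis by (simp add: G_def)
  qed
  have g_bounds: "0 \<le> g i t" "g i t \<le> 1" for i t
    using G_bounds bump_bounds by (auto simp: g_def)
  have g_outside: "g i t = 0" if "t \<notin> {0..1}" for i t
  proof -
    have "bump t = 0" "bump (2 * t / \<delta>) = 0"
      using that \<delta>(1) \<delta>1 by (auto intro!: bump_eq_0 simp: field_simps)
    then show ?thesis using G_bounds[of t] that by (simp add: g_def)
  qed
  note tf = test_function_prod[of g, OF smooth_g g_outside]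
  have u: "test_function u" unfolding u_def by (rule tf(1))
  have u_bound: "norm (u x) \<le> indicator (cbox 0 1) x" for x
  proof (cases "x \<in> cbox 0 1")
    case True
    have "0 \<le> u x" "u x \<le> 1"
      unfolding u_def using g_bounds by (auto intro: prod_nonneg prod_le_1)
    then show ?thesis using True by simp
  next
    case False
    then show ?thesis using tf(2) by (simp add: u_def)
  qed
  have G': "(G has_real_derivative G' t) (at t)" for t
    unfolding G_def G'_def
  proof (rule DERIV_sum)
    fix p
    have "((\<lambda>t. 2 * (t - p) / \<epsilon>) has_real_derivative 2 / \<epsilon>) (at t)"
      using \<epsilon>(1) by (auto intro!: derivative_eq_intros)
    from DERIV_chain2[OF b'(1) this]
    show "((\<lambda>t. bump (2 * (t - p) / \<epsilon>)) has_real_derivative 2 / \<epsilon> * b' (2 * (t - p) / \<epsilon>)) (at t)"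
      by (simp add: mult.commute)
  qed
  have "\<exists>f'. \<forall>t. (g i has_real_derivative f' t) (at t)" for i
    using smooth_upto_SucD[OF smooth_g[of "Suc 0" i]] by blast
  then obtain h' where h': "\<And>i t. (g i has_real_derivative h' i t) (at t)" by metis
  have "h' 5 = G'"
    using h'[of 5] G' DERIV_unique by (force simp: g_def fun_eq_iff)
  then have du: "partial_deriv 5 u x = (\<Prod>i\<in>UNIV. (g(5 := G')) i (x$i))" for x
    unfolding u_def using partial_deriv_prod(2)[of g h' 5 x] h' by simp
  have split5: "(\<Prod>i\<in>UNIV. (g(5 := G')) i (x$i))
      = bump (x$1) * bump (2 * x$2 / \<delta>) * bump (x$3) * bump (x$4) * G' (x$5)" for x :: "real^5"
    unfolding UNIV_5 by (simp add: g_def)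
  have E: "?E \<in> sets borel" using closed_cone_union[OF K] by simp
  note d = test_function_C1[OF u]
  have int: "integrable lborel (\<lambda>x. indicator ?E x * partial_deriv 5 u x)"
  proof -
    have "integrable lborel (partial_deriv 5 u)"
      using d(2) d(4)
    proof (rule integrable_continuous_compact_support)
      show "partial_deriv 5 u x = 0" if "x \<notin> closure {x. u x \<noteq> 0}" for x
        using frechet_derivative_outside_support[OF that] by (simp add: partial_deriv_def)
    qed
    then show ?thesis using integrable_mult_indicator[of ?E lborel "partial_deriv 5 u"] E by simp
  qed
  let ?e = "\<lambda>i. axis i 1 :: real^5"
  let ?I = "Basis - {?e 5}"
  let ?M = "\<Pi>\<^sub>M c\<in>?I. lborel :: real measure"
  let ?Q = "\<lambda>(z, y). y *\<^sub>R ?e 5 + (\<Sum>c\<in>?I. z c *\<^sub>R c)"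
  let ?F = "\<lambda>x. indicator ?E x * partial_deriv 5 u x"
  have e5: "?e 5 \<in> Basis" by simp
  note Q = lborel_split_coordinate[OF e5]
  interpret product_sigma_finite "\<lambda>_::real^5. lborel :: real measure" by standard
  interpret pair_sigma_finite ?M "lborel :: real measure"
    by (intro pair_sigma_finite.intro sigma_finite lborel.sigma_finite_measure_axioms) simp
  have Q_comp: "?Q (z, y) $ i = (if i = 5 then y else z (?e i))" for z y i
  proof -
    have "(\<Sum>c\<in>?I. z c *\<^sub>R c) $ i = (\<Sum>c\<in>?I. z c * (c \<bullet> ?e i))"
      by (simp add: inner_axis)
    also have "\<dots> = (\<Sum>c\<in>?I. if c = ?e i then z (?e i) else 0)"
      by (intro sum.cong) (auto simp: inner_not_same_Basis)
    also have "\<dots> = (if i = 5 then 0 else z (?e i))"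
      by (simp add: axis_eq_axis)
    finally show ?thesis by (simp add: axis_def)
  qed
  have int_Q: "integrable (?M \<Otimes>\<^sub>M lborel) (\<lambda>x. ?F (?Q x))"
    using Q(1) by (rule integrable_distr) (use int Q(2) in simp)
  let ?R = "\<lambda>z. LINT y|lborel. ?F (?Q (z, y))"
  have eq: "(LINT x|lborel. ?F x) = (LINT z|?M. ?R z)"
  proof -
    have "(LINT x|lborel. ?F x) = (LINT x|distr (?M \<Otimes>\<^sub>M lborel) borel ?Q. ?F x)"
      using Q(2) by simp
    also have "\<dots> = (LINT x|(?M \<Otimes>\<^sub>M lborel). ?F (?Q x))"
      using int by (intro integral_distr Q(1)) auto
    also have "\<dots> = (LINT z|?M. ?R z)" by (rule integral_fst'[OF int_Q, symmetric])
    finally show ?thesis .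
  qed
  have int_R: "integrable ?M ?R" by (rule integrable_fst'[OF int_Q])
  \<comment> \<open>Unless w = 2 x_2/delta and x_4 both lie in (0,1), both sides vanish with the
    bump factors; otherwise \<open>neighbourhood_slice_integral\<close> computes the slice.\<close>
  have R: "?R z = bump (z (?e 1)) * bump (2 * z (?e 2) / \<delta>) * bump (z (?e 3)) * bump (z (?e 4))
      * (card P * bump (sqrt ((2 * z (?e 2) / \<delta>) ^ 3 * z (?e 4))))" for z
  proof -
    let ?w = "2 * z (?e 2) / \<delta>" and ?x4 = "z (?e 4)"
    let ?h = "bump (z (?e 1)) * bump ?w * bump (z (?e 3)) * bump ?x4"
    have F: "?F (?Q (z, y)) = indicator ?E (?Q (z, y)) * (?h * G' y)" for y
      unfolding du split5 unfolding Q_comp by simp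
    show ?thesis
    proof (cases "?w \<in> {0<..<1} \<and> ?x4 \<in> {0<..<1}")
      case False
      then have h0: "?h = 0" using bump_eq_0 by auto
      show ?thesis unfolding F h0 by simp
    next
      case True
      let ?r = "\<epsilon> / 2 * sqrt (?w ^ 3 * ?x4)"
      have wx4: "0 < ?w" "?w \<le> 1" "0 < ?x4" "?x4 < 1" using True by auto
      have "?w ^ 3 * ?x4 \<le> 1 * ?x4"
        using wx4 by (intro mult_right_mono power_le_one) auto
      moreover have "0 < ?w ^ 3 * ?x4"
        using wx4(3) zero_less_power[OF wx4(1)] by (rule mult_pos_pos[rotated])
      ultimately have wx: "0 < ?w ^ 3 * ?x4" "?w ^ 3 * ?x4 < 1" using wx4(4) by linarith+
      then have r: "0 \<le> ?r" "?r < \<epsilon> / 2" using \<epsilon>(1) by simp_all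
      \<comment> \<open>The relation delta^3 = eps^2 turns eps^2/4 into delta^3/4; the powers of
        delta then cancel against w^3 and leave the squared radius of the cone slice.\<close>
      have "?r\<^sup>2 = \<delta> ^ 3 / 4 * (?w ^ 3 * ?x4)"
        using wx \<delta>(2) by (simp add: power_mult_distrib power_divide)
      also have "\<dots> = 2 * z (?e 2) ^ 3 * ?x4"
        using \<delta>(1) by (simp add: power_divide power_mult_distrib)
      finally have r2: "?r\<^sup>2 = 2 * z (?e 2) ^ 3 * ?x4" .
      have "0 < z (?e 2)" using True \<delta>(1) by (simp add: zero_less_divide_iff)
      then have "indicator ?E (?Q (z, y)) = (indicator {y. \<exists>t\<in>K. (y - t)\<^sup>2 \<le> ?r\<^sup>2} y :: real)" for y
        using True unfolding r2 indicator_def cone_union_iff Q_comp by simp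
      then have "?R z = (LINT y|lborel. ?h * (indicator {y. \<exists>t\<in>K. (y - t)\<^sup>2 \<le> ?r\<^sup>2} y * G' y))"
        unfolding F by (simp add: mult_ac)
      also have "\<dots> = ?h * (LINT y|lborel. indicator {y. \<exists>t\<in>K. (y - t)\<^sup>2 \<le> ?r\<^sup>2} y * G' y)"
        by simp
      also have "\<dots> = ?h * (card P * bump (2 * ?r / \<epsilon>))"
        unfolding G'_def using neighbourhood_slice_integral[OF \<epsilon>(1) P(1) P(2) P(4) r b'] by simp
      also have "2 * ?r / \<epsilon> = sqrt (?w ^ 3 * ?x4)" using \<epsilon>(1) by simp
      finally show ?thesis .
    qed
  qed
  \<comment> \<open>The x_2 range amounts to 1/2 <= w <= 3/4. Then sqrt (w^3 x_4) and the other bump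
    arguments lie in [1/16, 3/4], and five bumps give the factor exp(-32)^5. The volume is delta/8
    times (1/2)^3, which explains the 64.\<close>
  define Box where "Box = Pi\<^sub>E ?I (\<lambda>c. if c = ?e 2 then {\<delta> / 4..3 / 8 * \<delta>} else {1 / 4..3 / 4})"
  have lower: "card P * ?c ^ 5 * indicator Box z \<le> ?R z" for z
  proof (cases "z \<in> Box")
    case True
    let ?w = "2 * z (?e 2) / \<delta>" and ?x4 = "z (?e 4)"
    have z: "z (?e i) \<in> {1 / 4..3 / 4}" if "i \<in> {1, 3, 4}" for i
      using PiE_mem[OF True[unfolded Box_def], of "?e i"] that by (auto simp: axis_eq_axis)
    have z2: "z (?e 2) \<in> {\<delta> / 4..3 / 8 * \<delta>}"
      using PiE_mem[OF True[unfolded Box_def], of "?e 2"] by (simp add: axis_eq_axis)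
    then have w: "1 / 2 \<le> ?w" "?w \<le> 3 / 4" using \<delta>(1) by (auto simp: field_simps)
    have "(1 / 16)\<^sup>2 \<le> (1 / 2) ^ 3 * (1 / 4 :: real)" by (simp add: power2_eq_square power3_eq_cube)
    also have "\<dots> \<le> ?w ^ 3 * ?x4" using w z[of 4] by (intro mult_mono power_mono) auto
    finally have s1: "1 / 16 \<le> sqrt (?w ^ 3 * ?x4)" by (rule real_le_rsqrt)
    have "?w ^ 3 * ?x4 \<le> (3 / 4) ^ 3 * (3 / 4 :: real)"
      using w z[of 4] by (intro mult_mono power_mono) auto
    also have "\<dots> \<le> (3 / 4)\<^sup>2" by (simp add: power2_eq_square power3_eq_cube)
    finally have s2: "sqrt (?w ^ 3 * ?x4) \<le> 3 / 4" by (intro real_le_lsqrt) auto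
    have "?c * ?c * ?c * ?c * ?c \<le> bump (z (?e 1)) * bump ?w * bump (z (?e 3)) * bump ?x4
        * bump (sqrt (?w ^ 3 * ?x4))"
      using z[of 1] z[of 3] z[of 4] w s1 s2 bump_bounds(1)
      by (intro mult_mono bump_lower_bound) auto
    then have "card P * (?c * ?c * ?c * ?c * ?c) \<le> card P * (bump (z (?e 1)) * bump ?w * bump (z (?e 3))
        * bump ?x4 * bump (sqrt (?w ^ 3 * ?x4)))"
      by (rule mult_left_mono) simp
    then show ?thesis unfolding R using True by (simp add: eval_nat_numeral mult_ac)
  next
    case False
    then show ?thesis unfolding R using bump_bounds(1) by simp
  qed
  have Box: "Box \<in> sets ?M" unfolding Box_def by (intro sets_PiM_I_finite) auto
  have I_eq: "?I = ?e ` {1, 2, 3, 4}"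
  proof -
    have "(Basis :: (real^5) set) = range ?e" by (auto simp: Basis_vec_def)
    then show ?thesis unfolding UNIV_5 by (auto simp: axis_eq_axis)
  qed
  have "emeasure ?M Box = (\<Prod>c\<in>?I. emeasure lborel (if c = ?e 2 then {\<delta> / 4..3 / 8 * \<delta>} else {1 / 4..3 / 4}))"
    unfolding Box_def by (rule emeasure_PiM) auto
  also have "\<dots> = (\<Prod>i\<in>{1, 2, 3, 4 :: 5}. emeasure lborel (if i = 2 then {\<delta> / 4..3 / 8 * \<delta>} else {1 / 4..3 / 4}))"
    unfolding I_eq by (subst prod.reindex) (auto simp: inj_on_def axis_eq_axis)
  also have "\<dots> = ennreal (1 / 2) * (ennreal (\<delta> / 8) * (ennreal (1 / 2) * ennreal (1 / 2)))"
    using \<delta>(1) by simp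
  also have "\<dots> = ennreal (1 / 2 * (\<delta> / 8 * (1 / 2 * (1 / 2))))"
  proof -
    have "ennreal (x * y) = ennreal x * ennreal y" if "0 < x" "0 < y" for x y
      using that by (intro ennreal_mult) simp_all
    then show ?thesis using \<delta>(1) by (metis mult_pos_pos half_gt_zero zero_less_one divide_pos_pos zero_less_numeral)
  qed
  finally have Box_emeasure: "emeasure ?M Box = ennreal (\<delta> / 64)" by simp
  then have Box_measure: "measure ?M Box = \<delta> / 64"
    using \<delta>(1) by (simp add: measure_def)
  have "?c ^ 5 / 64 * (card P * \<delta>) = (LINT z|?M. card P * ?c ^ 5 * indicator Box z)"
    using Box Box_measure by simp
  also have "\<dots> \<le> (LINT z|?M. ?R z)"
    using Box Box_emeasure by (intro integral_mono int_R lower integrable_mult_right integrable_real_indicator) auto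
  also have "\<dots> = (LINT x:?E|lebesgue. partial_deriv 5 u x)"
    unfolding eq[symmetric]
    by (rule set_integral_lebesgue_eq_lborel[symmetric, OF E borel_measurable_continuous_onI[OF d(2)]])
  finally show thesis using that u u_bound by blast
qed

text \<open>Gives one constant for the pairings with all test functions dominated by the indicator
  of a fixed compact set, to be set against the growing variation.\<close>

lemma integral_bounded_by_indicator:
  fixes u :: "real^5 \<Rightarrow> real"
  assumes "radon_measure \<mu>" "compact S" "continuous_on UNIV u" "\<And>x. norm (u x) \<le> indicator S x"
  shows "norm (LINT x|\<mu>. u x) \<le> measure \<mu> S"
proof -
  have S: "S \<in> sets \<mu>" "emeasure \<mu> S < \<infinity>"
    using assms(1,2) by (auto simp: radon_measure_def borel_compact)
  then have int: "integrable \<mu> (indicator S :: _ \<Rightarrow> real)" by (intro integrable_real_indicator)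
  have "u \<in> borel_measurable borel" using assms(3) by (rule borel_measurable_continuous_onI)
  then have u: "u \<in> borel_measurable \<mu>"
    using assms(1) measurable_cong_sets[of \<mu> borel borel borel] by (auto simp: radon_measure_def)
  have "integrable \<mu> u"
    by (rule Bochner_Integration.integrable_bound[OF int u]) (use assms(4) in auto)
  then have "norm (LINT x|\<mu>. u x) \<le> (LINT x|\<mu>. indicator S x)"
    using int by (rule Bochner_Integration.integral_norm_bound_integral) (use assms(4) in auto)
  then show ?thesis using S by simp
qed

text \<open>The masses of the two measures on the unit cube would bound 2^n delta uniformly in n >=
  1, where delta^3 = (a_n/2^n)^2. Since (2^n delta)^3 = 2^n a_n^2, this contradicts the growth
  condition.\<close>

lemma (in fat_cantor) not_locally_finite_perimeter:
  assumes "filterlim (\<lambda>n. 2 ^ n * (a n)\<^sup>2) at_top sequentially"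
  shows "\<not> locally_finite_perimeter (cone_union (cantor_set a))"
proof
  let ?E = "cone_union (cantor_set a)" and ?S = "cbox 0 1 :: (real^5) set"
  let ?c = "exp (- 32) ^ 5 / 64 :: real"
  assume "locally_finite_perimeter ?E"
  then obtain \<mu> \<nu> where \<mu>: "radon_measure \<mu>" and \<nu>: "radon_measure \<nu>"
    and rep: "\<And>u. test_function u \<Longrightarrow>
      - (LINT x:?E|lebesgue. partial_deriv 5 u x) = (LINT x|\<mu>. u x) - (LINT x|\<nu>. u x)"
    unfolding locally_finite_perimeter_def by blast
  define C where "C = measure \<mu> ?S + measure \<nu> ?S"
  \<comment> \<open>Step 0 is left out because \<open>cantor_gaps\<close> describes the gaps cut
    from segments of a preceding step.\<close>
  have bound: "2 ^ n * (a n)\<^sup>2 \<le> (C / ?c) ^ 3" if n: "n = Suc m" for n m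
  proof -
    let ?\<epsilon> = "cantor_gap a n"
    define \<delta> where "\<delta> = root 3 (?\<epsilon>\<^sup>2)"
    have \<epsilon>: "0 < ?\<epsilon>" "?\<epsilon> < 1" using cantor_gap_pos cantor_gap_less_1 by auto
    have \<delta>: "0 < \<delta>" "\<delta> ^ 3 = ?\<epsilon>\<^sup>2" using \<epsilon>(1) by (simp_all add: \<delta>_def)
    obtain P where P: "finite P" "card P = 2 ^ n"
      "\<And>p. p \<in> P \<Longrightarrow> p \<in> cantor_set a" "\<And>p. p \<in> P \<Longrightarrow> p + ?\<epsilon> \<in> cantor_set a"
      "\<And>p x. p \<in> P \<Longrightarrow> x \<in> cantor_set a \<Longrightarrow> x \<le> p \<or> p + ?\<epsilon> \<le> x"
      by (rule cantor_gaps[of m, folded n]) (rule that)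
    obtain u where u: "test_function u" "\<And>x. norm (u x) \<le> indicator ?S x"
      "?c * (card P * \<delta>) \<le> (LINT x:?E|lebesgue. partial_deriv 5 u x)"
      by (rule gap_test_function[OF compact_cantor_set \<epsilon> \<delta> P(1) P(3,4,5) cantor_set_subset]) (assumption | rule that)+
    have "continuous_on UNIV u" using test_function_C1[OF u(1)] by blast
    then have "norm (LINT x|\<mu>. u x) \<le> measure \<mu> ?S" "norm (LINT x|\<nu>. u x) \<le> measure \<nu> ?S"
      using integral_bounded_by_indicator \<mu> \<nu> u(2) compact_cbox by blast+
    then have "?c * (card P * \<delta>) \<le> C"
      using rep[OF u(1)] u(3) by (simp add: C_def)
    then have "2 ^ n * \<delta> \<le> C / ?c"
      using P(2) by (simp add: field_simps)
    then have "(2 ^ n * \<delta>) ^ 3 \<le> (C / ?c) ^ 3"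
      using \<delta>(1) by (intro power_mono) auto
    moreover have "(2 ^ n * \<delta>) ^ 3 = 2 ^ n * (a n)\<^sup>2"
    proof -
      have "(2 ^ n * \<delta>) ^ 3 = (2 ^ n) ^ 3 * (a n / 2 ^ n)\<^sup>2"
        using \<delta>(2) by (simp add: power_mult_distrib cantor_gap_def)
      also have "\<dots> = 2 ^ n * (a n)\<^sup>2"
        by (simp add: power_divide power3_eq_cube power2_eq_square)
      finally show ?thesis .
    qed
    ultimately show ?thesis by simp
  qed
  have "eventually (\<lambda>n. (C / ?c) ^ 3 < 2 ^ n * (a n)\<^sup>2) sequentially"
    using assms by (simp add: filterlim_at_top_dense)
  then obtain N where "\<And>n. n \<ge> N \<Longrightarrow> (C / ?c) ^ 3 < 2 ^ n * (a n)\<^sup>2"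
    by (auto simp: eventually_sequentially)
  from this[of "Suc N"] bound[of "Suc N" N] show False by simp
qed

theorem theorem6p2:
  fixes a :: "nat \<Rightarrow> real" and E :: "(real^5) set"
  assumes "\<And>j. 0 < a j"
    and "summable a"
    and "(\<Sum>j. a j) < 1"
    and "filterlim (\<lambda>n. 2 ^ n * (a n)\<^sup>2) at_top sequentially"
    and "E = (\<Union>t\<in>cantor_set a. left_translation (F23_exp 5 t) ` cone_C)"
  shows "constant_normal E \<and> \<not> locally_finite_perimeter E"
proof -
  interpret fat_cantor a using assms(1-3) by unfold_locales
  have "E = cone_union (cantor_set a)" using assms(5) by (simp add: cone_union_def)
  then show ?thesis
    using constant_normal_cone_union[OF compact_cantor_set] not_locally_finite_perimeter[OF assms(4)]
    by simp
qed

end
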